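(* Let $d=n-m$ and consider the skew-linear system $$\dot{\mathbf y}=A(\boldsymbol\theta)\mathbf y,\qquad\dot{\boldsymbol\theta}=\boldsymbol\omega,\qquad\mathbf y\in\mathbb R^{d},\ \boldsymbol\theta\in\mathbb T^m,$$ where $A(\boldsymbol\theta)$ is a matrix, $2\pi$-periodic in each $\theta_j$ and sufficiently smooth, $\boldsymbol\omega\in\mathbb R^m$ is a constant incommensurable frequency vector with $|\mathbf k\cdot\boldsymbol\omega|\ge c/|\mathbf k|^\gamma$ for all $\mathbf k\in\mathbb Z^m\setminus\{0\}$, for some $c,\gamma>0$, and the spectrum of the quasi-periodic matrix $A(\boldsymbol\theta+\boldsymbol\omega t)$ is full, so that a quasi-Floquet reduction exists. Let the quasi-Floquet exponents $\boldsymbol\mu=(\mu_1,\dots,\mu_{d})$ (eigenvalues of the quasi-Floquet matrix $B$) be distinct. Any vector-valued function $\mathbf G(\mathbf y,\boldsymbol\theta)$ that is analytic in $\mathbf y$ and $L^2$ in $\boldsymbol\theta$ can be expanded into eigenfunctions of the associated Koopman operator as $$\mathbf G(\mathbf y,\boldsymbol\theta)=\sum_{\mathbf m\in\mathbb N^{d},\,\mathbf k\in\mathbb Z^m}\mathbf a_{\mathbf m\mathbf k}\,\mathbf z^{\mathbf m}(\mathbf y,\boldsymbol\theta)\,e^{i\mathbf k\cdot\boldsymbol\theta},$$ where $\mathbf a_{\mathbf m\mathbf k}$ are constant Koopman modes, $\mathbf m=(m_1,\dots,m_{d})$, $\mathbf z(\mathbf y,\boldsymbol\theta)=(z_1,\dots,z_{d})$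 are the principal Koopman eigenfunctions defined by $\mathbf z(\mathbf y,\boldsymbol\theta)=V^{-1}P^{-1}(\boldsymbol\theta)\mathbf y$, $V$ diagonalizes $B$, and $$\mathbf z^{\mathbf m}(\mathbf y,\boldsymbol\theta)e^{i\mathbf k\cdot\boldsymbol\theta}=z_1^{m_1}(\mathbf y,\boldsymbol\theta)\cdots z_{d}^{m_{d}}(\mathbf y,\boldsymbol\theta)e^{i\mathbf k\cdot\boldsymbol\theta}$$ is an eigenfunction of the Koopman operator corresponding to the eigenvalue $e^{(\mathbf m\cdot\boldsymbol\mu+i\mathbf k\cdot\boldsymbol\omega)t}$.
   Context: $U^tf=f\circ S^t$ is the Koopman operator; an eigenfunction with eigenvalue $e^{\lambda t}$ satisfies $U^t\phi=e^{\lambda t}\phi$. $\mathbb N$ includes $0$. The spectrum of the quasi-periodic matrix $A(\boldsymbol\theta+\boldsymbol\omega t)$ is the set of $\lambda\in\mathbb R$ for which $\dot{\mathbf y}=(A(\boldsymbol\theta+\boldsymbol\omega t)-\lambda I)\mathbf y$ does not have an exponential dichotomy; it is full if it consists of as many isolated points as the dimension of $\mathbf y$. Under these hypotheses (Sell) there are an invertible matrix function $P(\boldsymbol\theta)$, $2\pi$-periodic in each $\theta_j$, and a constant matrix $B$ (the quasi-Floquet matrix) such that $\mathbf y=P(\boldsymbol\theta)\tilde{\mathbf y}$ transforms the system into $\dot{\tilde{\mathbf y}}=B\tilde{\mathbf y}$; $V^{-1}BV=\mathrm{diag}(\mu_1,\dots,\mu_{d})$. "Analytic in $\mathbf y$ and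 $L^2$ in $\boldsymbol\theta$" means $\mathbf G=\sum_{\mathbf m}\mathbf b_{\mathbf m}(\boldsymbol\theta)\mathbf y^{\mathbf m}$ (convergent power series in $\mathbf y$) with coefficients in $L^2(\mathbb T^m)$; the Fourier expansions in $\boldsymbol\theta$ converge in $L^2$. *)

theory Defs
  imports "HOL-Analysis.Analysis"
begin

text \<open>
  Functions on the torus are represented by functions of the lifted angle in
  \<^typ>\<open>real^'m\<close> that are \<open>2\<pi>\<close>-periodic in each component; the torus carries
  the (unnormalised) Lebesgue measure of the fundamental cube.
\<close>

definition torus_periodic :: "(real^'m \<Rightarrow> 'b) \<Rightarrow> bool" where
  "torus_periodic f \<longleftrightarrow> (\<forall>\<theta> j. f (\<theta> + axis j (2 * pi)) = f \<theta>)"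

definition torus :: "(real^'m) measure" where
  "torus = lebesgue_on {\<theta>. \<forall>j. 0 \<le> \<theta> $ j \<and> \<theta> $ j \<le> 2 * pi}"

definition L2_torus :: "(real^'m \<Rightarrow> 'b::euclidean_space) \<Rightarrow> bool" where
  "L2_torus f \<longleftrightarrow> torus_periodic f \<and> f \<in> borel_measurable torus
     \<and> integrable torus (\<lambda>\<theta>. (norm (f \<theta>))\<^sup>2)"

text \<open>
  Class \<open>C\<^sup>r\<close>, by existence and continuity of the iterated partial derivatives.
\<close>

primrec C_class :: "nat \<Rightarrow> (real^'m \<Rightarrow> 'b::real_normed_vector) \<Rightarrow> bool" where
  "C_class 0 f \<longleftrightarrow> continuous_on UNIV f"
| "C_class (Suc r) f \<longleftrightarrow> continuous_on UNIV f \<and>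
     (\<forall>j. \<exists>g. C_class r g \<and>
        (\<forall>x. ((\<lambda>s. f (x + s *\<^sub>R axis j 1)) has_vector_derivative g x) (at 0)))"

definition int_vec :: "int^'m \<Rightarrow> real^'m" where
  "int_vec k = (\<chi> j. of_int (k $ j))"

text \<open>
  For \<open>c > 0\<close> this contains incommensurability of the frequencies.
\<close>

definition diophantine :: "real \<Rightarrow> real \<Rightarrow> real^'m \<Rightarrow> bool" where
  "diophantine c \<gamma> \<omega> \<longleftrightarrow>
     (\<forall>k. k \<noteq> 0 \<longrightarrow> \<bar>int_vec k \<bullet> \<omega>\<bar> \<ge> c / norm (int_vec k) powr \<gamma>)"

definition exp_dichotomy :: "(real \<Rightarrow> real^'d^'d) \<Rightarrow> bool" where
  "exp_dichotomy C \<longleftrightarrow> (\<exists>(X :: real \<Rightarrow> real^'d^'d) (Q :: real^'d^'d) K \<alpha>.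
     (\<forall>t. (X has_vector_derivative C t ** X t) (at t)) \<and> (\<forall>t. invertible (X t)) \<and>
     Q ** Q = Q \<and> K > 0 \<and> \<alpha> > 0 \<and>
     (\<forall>s t. s \<le> t \<longrightarrow>
        norm (X t ** Q ** matrix_inv (X s)) \<le> K * exp (- \<alpha> * (t - s))) \<and>
     (\<forall>s t. t \<le> s \<longrightarrow>
        norm (X t ** (mat 1 - Q) ** matrix_inv (X s)) \<le> K * exp (- \<alpha> * (s - t))))"

definition dichotomy_spectrum :: "(real \<Rightarrow> real^'d^'d) \<Rightarrow> real set" where
  "dichotomy_spectrum C = {s. \<not> exp_dichotomy (\<lambda>t. C t - mat s)}"

definition full_spectrum :: "(real \<Rightarrow> real^'d^'d) \<Rightarrow> bool" where
  "full_spectrum C \<longleftrightarrow> card (dichotomy_spectrum C) = CARD('d) \<and> discrete (dichotomy_spectrum C)"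

definition cvec :: "real^'d \<Rightarrow> complex^'d" where
  "cvec y = (\<chi> i. complex_of_real (y $ i))"

definition cmat :: "real^'d^'d \<Rightarrow> complex^'d^'d" where
  "cmat = map_matrix complex_of_real"

definition diag_mat :: "complex^'d \<Rightarrow> complex^'d^'d" where
  "diag_mat \<mu> = (\<chi> i j. if i = j then \<mu> $ i else 0)"

text \<open>
  The last clause says that, along every orbit \<open>\<theta> + t \<omega>\<close>, the substitution
  \<open>y(t) = P(\<theta> + t \<omega>) w(t)\<close> turns the solutions of \<open>y' = A(\<theta> + t \<omega>) y\<close> exactly into
  those of \<open>w' = B w\<close>.  The transformation may be complex: with \<open>P\<close> required to be
  \<open>2\<pi>\<close>-periodic (and not just \<open>4\<pi>\<close>-periodic), a real one need not exist.
  A real \<open>P\<close> and \<open>B\<close> are included through the embedding of the real matrices.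
\<close>

definition quasi_floquet_reduction ::
  "(real^'m \<Rightarrow> real^'d^'d) \<Rightarrow> real^'m \<Rightarrow> (real^'m \<Rightarrow> complex^'d^'d) \<Rightarrow> complex^'d^'d \<Rightarrow> bool"
where
  "quasi_floquet_reduction A \<omega> P B \<longleftrightarrow>
     continuous_on UNIV P \<and> torus_periodic P \<and> (\<forall>\<theta>. invertible (P \<theta>)) \<and>
     (\<forall>\<theta> w. (\<forall>t. (w has_vector_derivative B *v w t) (at t)) \<longleftrightarrow>
        (\<forall>t. ((\<lambda>t. P (\<theta> + t *\<^sub>R \<omega>) *v w t) has_vector_derivative
               cmat (A (\<theta> + t *\<^sub>R \<omega>)) *v (P (\<theta> + t *\<^sub>R \<omega>) *v w t)) (at t)))"

definition skew_field ::
  "(real^'m \<Rightarrow> real^'d^'d) \<Rightarrow> real^'m \<Rightarrow> (real^'d) \<times> (real^'m) \<Rightarrow> (real^'d) \<times> (real^'m)"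
where
  "skew_field A \<omega> = (\<lambda>(y, \<theta>). (A \<theta> *v y, \<omega>))"

text \<open>
  \<open>flow F t x\<close> is the value at time \<open>t\<close> of the solution of \<open>u' = F u\<close>, \<open>u 0 = x\<close>;
  it is meaningful when that solution exists for all times and is unique, as it
  does for \<^const>\<open>skew_field\<close> with a continuous matrix function.
\<close>

definition flow :: "('s::real_normed_vector \<Rightarrow> 's) \<Rightarrow> real \<Rightarrow> 's \<Rightarrow> 's" where
  "flow F t x =
     (THE u. u 0 = x \<and> (\<forall>s. (u has_vector_derivative F (u s)) (at s))) t"

definition koopman ::
  "('s::real_normed_vector \<Rightarrow> 's) \<Rightarrow> real \<Rightarrow> ('s \<Rightarrow> complex) \<Rightarrow> 's \<Rightarrow> complex" where
  "koopman F t f = f \<circ> flow F t"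

text \<open>
  \<open>\<phi>\<close> is an eigenfunction with eigenvalue \<open>exp (l t)\<close> for every \<open>t\<close>.
\<close>

definition koopman_eigenfunction ::
  "((real^'d) \<times> (real^'m) \<Rightarrow> (real^'d) \<times> (real^'m)) \<Rightarrow> complex \<Rightarrow>
   ((real^'d) \<times> (real^'m) \<Rightarrow> complex) \<Rightarrow> bool"
where
  "koopman_eigenfunction F l \<phi> \<longleftrightarrow>
     (\<forall>y. torus_periodic (\<lambda>\<theta>. \<phi> (y, \<theta>))) \<and> \<phi> \<noteq> (\<lambda>_. 0) \<and>
     (\<forall>t. koopman F t \<phi> = (\<lambda>x. exp (l * of_real t) * \<phi> x))"

definition mpow :: "'a::comm_monoid_mult^'d \<Rightarrow> nat^'d \<Rightarrow> 'a" where
  "mpow x m = (\<Prod>i\<in>UNIV. (x $ i) ^ (m $ i))"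

definition principal_eigenfunctions ::
  "(real^'m \<Rightarrow> complex^'d^'d) \<Rightarrow> complex^'d^'d \<Rightarrow> (real^'d) \<times> (real^'m) \<Rightarrow> complex^'d"
where
  "principal_eigenfunctions P V = (\<lambda>(y, \<theta>). matrix_inv V *v (matrix_inv (P \<theta>) *v cvec y))"

definition fourier_mode :: "int^'m \<Rightarrow> real^'m \<Rightarrow> complex" where
  "fourier_mode k \<theta> = exp (\<i> * complex_of_real (int_vec k \<bullet> \<theta>))"

text \<open>
  \<open>G(y, \<theta>)\<close> is the sum of a power series in \<open>y\<close> with coefficients in \<open>L\<^sup>2\<close>, converging on
  the ball of radius \<open>\<rho> \<in> (0, \<infinity>]\<close> around \<open>y = 0\<close>.  As the coefficients are \<open>L\<^sup>2\<close> functions,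
  null sets of \<open>\<theta>\<close> (not depending on \<open>y\<close>) are disregarded.
\<close>

definition analytic_L2 ::
  "ereal \<Rightarrow> ((real^'d) \<times> (real^'m) \<Rightarrow> complex^'q) \<Rightarrow> bool"
where
  "analytic_L2 \<rho> G \<longleftrightarrow> 0 < \<rho> \<and> (\<forall>y. torus_periodic (\<lambda>\<theta>. G (y, \<theta>))) \<and>
     (\<exists>b :: nat^'d \<Rightarrow> real^'m \<Rightarrow> complex^'q.
        (\<forall>m. L2_torus (b m)) \<and>
        (AE \<theta> in torus. \<forall>y. ereal (norm y) < \<rho> \<longrightarrow>
           ((\<lambda>m. mpow y m *\<^sub>R b m \<theta>) has_sum G (y, \<theta>)) UNIV))"

definition fourier_L2_sum ::
  "(int^'m \<Rightarrow> complex^'q) \<Rightarrow> (real^'m \<Rightarrow> complex^'q) \<Rightarrow> bool"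
where
  "fourier_L2_sum a f \<longleftrightarrow> L2_torus f \<and>
     ((\<lambda>K. \<integral>\<theta>. (norm (f \<theta> - (\<Sum>k\<in>K. fourier_mode k \<theta> *s a k)))\<^sup>2 \<partial>torus) \<longlongrightarrow> 0)
       (finite_subsets_at_top UNIV)"

text \<open>
  The double series \<open>\<Sum> a\<^sub>m\<^sub>k z\<^sup>m e\<^bsup>ik\<theta>\<^esup>\<close> with constant modes \<open>a\<^sub>m\<^sub>k\<close> represents \<open>G\<close> for \<open>|y| < r\<close>:
  the Fourier series multiplying each \<open>z\<^sup>m\<close> converges in \<open>L\<^sup>2\<close> (to \<open>c m\<close>), the
  power series in \<open>z\<close> converges pointwise for almost every \<open>\<theta>\<close>.
\<close>

definition koopman_expansion ::
  "ereal \<Rightarrow> ((real^'d) \<times> (real^'m) \<Rightarrow> complex^'d) \<Rightarrow> (nat^'d \<Rightarrow> int^'m \<Rightarrow> complex^'q) \<Rightarrow>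
   ((real^'d) \<times> (real^'m) \<Rightarrow> complex^'q) \<Rightarrow> bool"
where
  "koopman_expansion r z a G \<longleftrightarrow>
     (\<exists>c :: nat^'d \<Rightarrow> real^'m \<Rightarrow> complex^'q.
        (\<forall>m. fourier_L2_sum (a m) (c m)) \<and>
        (AE \<theta> in torus. \<forall>y. ereal (norm y) < r \<longrightarrow>
           ((\<lambda>m. mpow (z (y, \<theta>)) m *s c m \<theta>) has_sum G (y, \<theta>)) UNIV))"

end

theory Submission
  imports Defs
begin

text \<open>
  Along an orbit \<open>\<theta> + t\<omega>\<close> the reduction turns a real solution into \<open>w' = B w\<close>, so the coordinates
  \<open>z = V\<^sup>-\<^sup>1 P\<^sup>-\<^sup>1 y\<close> satisfy \<open>z\<^sub>i' = \<mu>\<^sub>i z\<^sub>i\<close>; this yields both the uniqueness of the flow and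
  the eigenvalue of \<open>z\<^sup>m e\<^bsup>ik\<theta>\<^esup>\<close>.  For the expansion, \<open>y = P V z\<close> is substituted into the power
  series of \<open>G\<close>; \<open>P\<close> and its inverse are bounded on the torus, so the rearranged series converges
  absolutely for small \<open>y\<close>, and the coefficient of \<open>z\<^sup>l\<close> is a finite sum of products of continuous
  and \<open>L\<^sup>2\<close> functions, hence \<open>L\<^sup>2\<close>.  Its Fourier series converges in \<open>L\<^sup>2\<close> because trigonometric
  polynomials are dense (Stone--Weierstrass) and Fourier sums are best approximations.
\<close>

section \<open>Fourier series of square-integrable functions on the torus\<close>

text \<open>The series of \<open>G\<close> is known to converge only at real \<open>y\<close>, while
  \<open>P V\<close> and \<open>z\<close> are complex. Absolute convergence is therefore extracted
  from a single real point: with all entries of \<open>P V\<close> and \<open>z\<close> replaced by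
  their moduli, every row sum is at most \<open>K * norm y\<close>, so the expanded series is
  majorised by the original one at the point with all coordinates equal to
  \<open>K * norm y\<close>. This point has norm at most \<open>CARD('d) * K * norm y\<close>, and
  keeping it inside the ball of radius \<rho> is what shrinks \<rho> to \<open>R\<close>; an
  infinite radius stays infinite. Since \<open>K\<close> is uniform in \<theta>, \<open>R\<close>
  does not depend on \<theta>. A linear substitution preserves the total degree, which is why each
  power of \<open>z\<close> collects only finitely many terms. On the Fourier side the obstacle is
  that the closed cube is not the torus: opposite faces have to be identified, and a continuous
  approximant on the cube need not respect that. Forcing approximants to vanish on all faces removes
  the conflict and costs nothing in the limit, the faces being null sets.\<close>

abbreviation cube :: "(real^'m) set" where
  "cube \<equiv> {\<theta>. \<forall>j. 0 \<le> \<theta> $ j \<and> \<theta> $ j \<le> 2 * pi}"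

lemma cube_eq: "(cube :: (real^'m) set) = cbox 0 (\<chi> j. 2 * pi)"
  by (auto simp: mem_box_cart)

lemma compact_cube [simp]: "compact (cube :: (real^'m) set)"
  unfolding cube_eq by simp

lemma cube_lebesgue [measurable]: "(cube :: (real^'m) set) \<in> sets lebesgue"
  unfolding cube_eq by simp

section \<open>The torus as a finite measure space and square integrability on it\<close>

lemma space_torus [simp]: "space torus = cube"
  by (simp add: torus_def)

lemma finite_measure_torus: "finite_measure (torus :: (real^'m) measure)"
proof
  have "emeasure (torus :: (real^'m) measure) (space torus) = emeasure lebesgue (cube :: (real^'m) set)"
    by (simp add: torus_def emeasure_restrict_space)
  then show "emeasure (torus :: (real^'m) measure) (space torus) \<noteq> \<infinity>"
    unfolding cube_eq using emeasure_lborel_cbox_finite[of 0 "\<chi> j::'m. 2 * pi"]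
    by (simp add: less_top)
qed

interpretation torus: finite_measure "torus :: (real^'m) measure"
  by (rule finite_measure_torus)

lemma measure_torus_pos: "0 < measure torus (cube :: (real^'m) set)"
proof -
  have "measure torus (cube :: (real^'m) set) = measure lebesgue (cbox 0 (\<chi> j. 2 * pi) :: (real^'m) set)"
    by (simp add: torus_def measure_restrict_space flip: cube_eq)
  also have "\<dots> > 0"
    by (simp add: content_cbox_cart prod_pos mem_box_cart not_le interval_ne_empty_cart)
  finally show ?thesis .
qed

lemma AE_torusI:
  assumes "negligible N" "\<And>\<theta>. \<theta> \<in> cube \<Longrightarrow> \<theta> \<notin> N \<Longrightarrow> P \<theta>"
  shows "AE \<theta> in torus. P (\<theta> :: real^'m)"
proof -
  have "AE \<theta> in lebesgue. \<theta> \<in> cube \<longrightarrow> P \<theta>"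
    using assms by (intro AE_I'[of N]) (auto simp: negligible_iff_null_sets)
  then show ?thesis
    unfolding torus_def by (subst AE_restrict_space_iff) auto
qed

lemma continuous_measurable_torus:
  "continuous_on UNIV f \<Longrightarrow> f \<in> borel_measurable (torus :: (real^'m) measure)"
  unfolding torus_def
  by (rule continuous_imp_measurable_on_sets_lebesgue[OF continuous_on_subset]) auto

lemma continuous_bounded_cube:
  fixes f :: "real^'m \<Rightarrow> 'b::real_normed_vector"
  assumes "continuous_on UNIV f"
  obtains C where "\<And>\<theta>. \<theta> \<in> cube \<Longrightarrow> norm (f \<theta>) \<le> C"
proof -
  have "bounded (f ` cube)"
    by (intro compact_imp_bounded compact_continuous_image continuous_on_subset[OF assms]) auto
  then show ?thesis
    using that by (auto simp: bounded_iff)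
qed

text \<open>\<open>L2_torus\<close> without periodicity: the continuous approximants constructed
  below need not be periodic.\<close>

definition square_integrable :: "(real^'m \<Rightarrow> 'b::euclidean_space) \<Rightarrow> bool" where
  "square_integrable f \<longleftrightarrow> f \<in> borel_measurable torus \<and> integrable torus (\<lambda>\<theta>. (norm (f \<theta>))\<^sup>2)"

lemma square_integrableD:
  assumes "square_integrable f"
  shows "f \<in> borel_measurable torus" "integrable torus (\<lambda>\<theta>. (norm (f \<theta>))\<^sup>2)"
  using assms by (auto simp: square_integrable_def)

lemma norm_add_square_le:
  "(norm (x + y))\<^sup>2 \<le> 2 * (norm x)\<^sup>2 + 2 * (norm (y :: 'a::real_normed_vector))\<^sup>2"
proof -
  have "(norm (x + y))\<^sup>2 \<le> (norm x + norm y)\<^sup>2"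
    by (intro power_mono norm_triangle_ineq) auto
  also have "\<dots> \<le> 2 * (norm x)\<^sup>2 + 2 * (norm y)\<^sup>2"
    using sum_squares_bound[of "norm x" "norm y"] by (simp add: power2_sum)
  finally show ?thesis .
qed

lemma square_integrable_bound:
  fixes f :: "real^'m \<Rightarrow> 'b::euclidean_space"
  assumes "f \<in> borel_measurable torus" "integrable torus g"
    and "\<And>\<theta>. \<theta> \<in> cube \<Longrightarrow> (norm (f \<theta>))\<^sup>2 \<le> g \<theta>"
  shows "square_integrable f"
  unfolding square_integrable_def
proof
  show "integrable torus (\<lambda>\<theta>. (norm (f \<theta>))\<^sup>2)"
  proof (rule Bochner_Integration.integrable_bound[OF assms(2)])
    show "AE \<theta> in torus. norm ((norm (f \<theta>))\<^sup>2) \<le> norm (g \<theta>)"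
    proof (rule AE_I2)
      fix \<theta> :: "real^'m" assume "\<theta> \<in> space torus"
      then have "(norm (f \<theta>))\<^sup>2 \<le> g \<theta>" using assms(3) by simp
      then show "norm ((norm (f \<theta>))\<^sup>2) \<le> norm (g \<theta>)" by simp
    qed
  qed (use assms(1) in measurable)
qed fact

lemma square_integrable_add:
  assumes "square_integrable f" "square_integrable g"
  shows "square_integrable (\<lambda>\<theta>. f \<theta> + g \<theta>)"
proof (rule square_integrable_bound)
  show "(\<lambda>\<theta>. f \<theta> + g \<theta>) \<in> borel_measurable torus"
    using assms[THEN square_integrableD(1)] by (rule borel_measurable_add)
  show "integrable torus (\<lambda>\<theta>. 2 * (norm (f \<theta>))\<^sup>2 + 2 * (norm (g \<theta>))\<^sup>2)"
    using assms[THEN square_integrableD(2)] by simp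
qed (rule norm_add_square_le)

lemma square_integrable_zero: "square_integrable (\<lambda>_. 0)"
  by (simp add: square_integrable_def)

lemma square_integrable_sum:
  assumes "finite I" "\<And>i. i \<in> I \<Longrightarrow> square_integrable (f i)"
  shows "square_integrable (\<lambda>\<theta>. \<Sum>i\<in>I. f i \<theta>)"
  using assms
proof (induction I)
  case (insert i I)
  then show ?case
    using square_integrable_add[of "f i" "\<lambda>\<theta>. \<Sum>i\<in>I. f i \<theta>"] by simp
qed (simp add: square_integrable_zero)

lemma square_integrable_continuous:
  fixes f :: "real^'m \<Rightarrow> 'b::euclidean_space"
  assumes "continuous_on UNIV f"
  shows "square_integrable f"
proof -
  obtain C where C: "\<And>\<theta>. \<theta> \<in> cube \<Longrightarrow> norm (f \<theta>) \<le> C"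
    by (rule continuous_bounded_cube[OF assms]) (rule that)
  show ?thesis
    by (rule square_integrable_bound[where g = "\<lambda>_. C\<^sup>2"])
      (simp_all add: continuous_measurable_torus assms power_mono C)
qed

lemma square_integrable_minus:
  "square_integrable f \<Longrightarrow> square_integrable (\<lambda>\<theta>. - f \<theta>)"
  by (simp add: square_integrable_def)

lemma square_integrable_diff:
  assumes "square_integrable f" "square_integrable g"
  shows "square_integrable (\<lambda>\<theta>. f \<theta> - g \<theta>)"
  using square_integrable_add[OF assms(1) square_integrable_minus[OF assms(2)]] by simp

lemma integrable_mult_cnj:
  assumes f: "square_integrable f" and g: "square_integrable g"
  shows "integrable torus (\<lambda>\<theta>. f \<theta> * cnj (g \<theta>))"
proof (rule Bochner_Integration.integrable_bound)
  show "integrable torus (\<lambda>\<theta>. (norm (f \<theta>))\<^sup>2 + (norm (g \<theta>))\<^sup>2)"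
    using assms[THEN square_integrableD(2)] by simp
  show "AE \<theta> in torus. norm (f \<theta> * cnj (g \<theta>)) \<le> norm ((norm (f \<theta>))\<^sup>2 + (norm (g \<theta>))\<^sup>2)"
  proof (rule AE_I2)
    fix \<theta>
    have "2 * (norm (f \<theta>) * norm (g \<theta>)) \<le> (norm (f \<theta>))\<^sup>2 + (norm (g \<theta>))\<^sup>2"
      using sum_squares_bound[of "norm (f \<theta>)" "norm (g \<theta>)"] by simp
    moreover have "0 \<le> norm (f \<theta>) * norm (g \<theta>)" by simp
    ultimately have "norm (f \<theta>) * norm (g \<theta>) \<le> (norm (f \<theta>))\<^sup>2 + (norm (g \<theta>))\<^sup>2"
      by linarith
    then show "norm (f \<theta> * cnj (g \<theta>)) \<le> norm ((norm (f \<theta>))\<^sup>2 + (norm (g \<theta>))\<^sup>2)"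
      by (simp add: norm_mult)
  qed
  show "(\<lambda>\<theta>. f \<theta> * cnj (g \<theta>)) \<in> borel_measurable torus"
  proof -
    have "f \<in> borel_measurable torus" "g \<in> borel_measurable torus" using assms[THEN square_integrableD(1)] by auto
    moreover have "cnj \<in> borel_measurable borel"
      by (intro borel_measurable_continuous_onI continuous_intros)
    ultimately show ?thesis by measurable
  qed
qed

section \<open>Orthogonality of the Fourier modes\<close>

lemma continuous_fourier_mode: "continuous_on UNIV (fourier_mode k)"
  unfolding fourier_mode_def by (intro continuous_intros)

lemma int_vec_add: "int_vec (k + l) = int_vec k + int_vec l"
  and int_vec_minus: "int_vec (- k) = - int_vec k"
  by (simp_all add: int_vec_def vec_eq_iff)

lemma fourier_mode_mult: "fourier_mode k \<theta> * fourier_mode l \<theta> = fourier_mode (k + l) \<theta>"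
  by (simp add: fourier_mode_def int_vec_add inner_add_left distrib_left exp_add)

lemma cnj_fourier_mode: "cnj (fourier_mode k \<theta>) = fourier_mode (- k) \<theta>"
  by (simp add: fourier_mode_def int_vec_minus exp_cnj)

lemma fourier_mode_0 [simp]: "fourier_mode 0 \<theta> = 1"
  by (simp add: fourier_mode_def int_vec_def inner_vec_def)

text \<open>Lebesgue measure is the image of the product of its coordinate measures under the map
  from coefficients to vectors, so Fubini applies factor by factor.\<close>

lemma integral_lborel_prod:
  fixes g :: "'a::euclidean_space \<Rightarrow> real \<Rightarrow> complex"
  assumes "\<And>b. b \<in> Basis \<Longrightarrow> integrable lborel (g b)"
  shows "(\<integral>x. (\<Prod>b\<in>Basis. g b (x \<bullet> b)) \<partial>lborel) = (\<Prod>b\<in>Basis. \<integral>x. g b x \<partial>lborel)"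
proof -
  interpret product_sigma_finite "\<lambda>_::'a. lborel :: real measure" ..
  have [measurable]: "g b \<in> borel_measurable borel" if "b \<in> Basis" for b
    using assms[OF that] by auto
  have "(\<integral>x. (\<Prod>b\<in>Basis. g b (x \<bullet> b)) \<partial>lborel) =
      (\<integral>x. (\<Prod>b\<in>Basis. g b (x \<bullet> b)) \<partial>distr (Pi\<^sub>M Basis (\<lambda>_. lborel)) borel (\<lambda>f. \<Sum>b\<in>Basis. f b *\<^sub>R b))"
    by (subst lborel_eq) simp
  also have "\<dots> = (\<integral>f. (\<Prod>b\<in>Basis. g b ((\<Sum>c\<in>Basis. f c *\<^sub>R c) \<bullet> b)) \<partial>Pi\<^sub>M Basis (\<lambda>_. lborel))"
    by (rule integral_distr) measurable
  also have "\<dots> = (\<integral>f. (\<Prod>b\<in>Basis. g b (f b)) \<partial>Pi\<^sub>M Basis (\<lambda>_. lborel))"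
    by simp
  also have "\<dots> = (\<Prod>b\<in>Basis. \<integral>x. g b x \<partial>lborel)"
    by (rule product_integral_prod) (use assms in auto)
  finally show ?thesis .
qed

text \<open>The primitive exp(i n x) / (i n) exists for \<open>n\<close> nonzero and takes equal
  values at 0 and 2 \<pi>.\<close>

lemma integral_exp_period:
  assumes "n \<noteq> 0"
  shows "(\<integral>x. indicator {0..2*pi} x *\<^sub>R exp (\<i> * of_real (of_int n * x)) \<partial>lborel) = 0"
proof -
  let ?F = "\<lambda>x::real. exp (\<i> * of_int n * of_real x) / (\<i> * of_int n)"
  have "(?F has_vector_derivative exp (\<i> * of_real (of_int n * x))) (at x within {0..2*pi})" for x
  proof -
    have "(?F has_vector_derivative (\<i> * of_int n * exp (\<i> * of_int n * of_real x)) / (\<i> * of_int n)) (at x)"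
      by (rule has_vector_derivative_real_field)
         (use assms in \<open>auto intro!: derivative_eq_intros\<close>)
    then show ?thesis
      using assms by (simp add: mult.assoc has_vector_derivative_at_within)
  qed
  moreover have "continuous_on {0..2*pi} (\<lambda>x. exp (\<i> * of_real (of_int n * x)))"
    by (intro continuous_intros)
  ultimately have "(\<integral>x. indicator {0..2*pi} x *\<^sub>R exp (\<i> * of_real (of_int n * x)) \<partial>lborel)
      = ?F (2 * pi) - ?F 0"
    by (intro integral_FTC_Icc) auto
  also have "exp (\<i> * of_int n * of_real (2 * pi)) = 1"
    using exp_eq_1[of "\<i> * of_int n * of_real (2 * pi)"] by auto
  finally show ?thesis by simp
qed

text \<open>A mode is a product of exponentials in the single coordinates, and so is the indicator
  of the cube. The integral factors, and a coordinate with \<open>k $ j\<close> nonzero contributes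
  a zero factor.\<close>

lemma integral_fourier_mode:
  assumes "k \<noteq> 0"
  shows "(\<integral>\<theta>. fourier_mode k \<theta> \<partial>(torus :: (real^'m) measure)) = 0"
proof -
  define g :: "real^'m \<Rightarrow> real \<Rightarrow> complex" where
    "g b x = indicator {0..2*pi} x *\<^sub>R exp (\<i> * of_real ((int_vec k \<bullet> b) * x))" for b x
  have g: "integrable lborel (g b)" for b
  proof -
    have "set_integrable lborel {0..2*pi} (\<lambda>x. exp (\<i> * of_real ((int_vec k \<bullet> b) * x)))"
      by (intro borel_integrable_atLeastAtMost' continuous_intros)
    then show ?thesis by (simp add: g_def[abs_def] set_integrable_def)
  qed
  have cube: "\<theta> \<in> cube \<longleftrightarrow> (\<forall>b\<in>Basis. \<theta> \<bullet> b \<in> {0..2*pi})" for \<theta> :: "real^'m"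
    by (auto simp: Basis_vec_def inner_axis)
  have prod: "indicator cube \<theta> *\<^sub>R fourier_mode k \<theta> = (\<Prod>b\<in>Basis. g b (\<theta> \<bullet> b))" for \<theta>
  proof (cases "\<theta> \<in> cube")
    case True
    then have "(\<Prod>b\<in>Basis. g b (\<theta> \<bullet> b)) = (\<Prod>b\<in>Basis. exp (\<i> * of_real ((int_vec k \<bullet> b) * (\<theta> \<bullet> b))))"
      unfolding cube g_def by (intro prod.cong) auto
    also have "\<dots> = fourier_mode k \<theta>"
      unfolding fourier_mode_def euclidean_inner[of "int_vec k" \<theta>]
      by (simp add: exp_sum sum_distrib_left)
    finally show ?thesis using True by simp
  next
    case False
    then obtain b where "b \<in> Basis" "\<theta> \<bullet> b \<notin> {0..2*pi}" unfolding cube by blast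
    then have "(\<Prod>b\<in>Basis. g b (\<theta> \<bullet> b)) = 0"
      by (intro prod_zero finite_Basis bexI[of _ b]) (auto simp: g_def)
    then show ?thesis using False by simp
  qed
  obtain j where j: "k $ j \<noteq> 0" using assms by (auto simp: vec_eq_iff)
  have "(\<integral>\<theta>. fourier_mode k \<theta> \<partial>(torus :: (real^'m) measure)) =
      (\<integral>\<theta>. indicator cube \<theta> *\<^sub>R fourier_mode k \<theta> \<partial>lebesgue)"
    unfolding torus_def by (rule integral_restrict_space) simp
  also have "\<dots> = (\<integral>\<theta>. indicator cube \<theta> *\<^sub>R fourier_mode k \<theta> \<partial>lborel)"
  proof (rule integral_completion)
    have "fourier_mode k \<in> borel_measurable borel"
      by (rule borel_measurable_continuous_onI[OF continuous_fourier_mode])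
    moreover have "(cube :: (real^'m) set) \<in> sets borel" unfolding cube_eq by simp
    ultimately show "(\<lambda>\<theta>::real^'m. indicator cube \<theta> *\<^sub>R fourier_mode k \<theta>) \<in> borel_measurable lborel"
      by simp
  qed
  also have "\<dots> = (\<Prod>b\<in>Basis. \<integral>x. g b x \<partial>lborel)"
    unfolding prod by (rule integral_lborel_prod[OF g])
  also have "\<dots> = 0"
  proof (rule prod_zero[OF finite_Basis bexI])
    have "int_vec k \<bullet> axis j 1 = of_int (k $ j)"
      by (simp add: int_vec_def inner_axis)
    then show "(\<integral>x. g (axis j 1) x \<partial>lborel) = 0"
      unfolding g_def using integral_exp_period[OF j] by simp
    show "axis j 1 \<in> (Basis :: (real^'m) set)" by (auto simp: Basis_vec_def)
  qed
  finally show ?thesis .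
qed

text \<open>The measure is not normalised, so the squared norm of each mode is the volume of the
  cube; \<open>fourier_coeff\<close> divides by it.\<close>

lemma fourier_mode_orthogonal:
  "(\<integral>\<theta>. fourier_mode k \<theta> * cnj (fourier_mode l \<theta>) \<partial>(torus :: (real^'m) measure)) =
     (if k = l then of_real (measure torus (cube :: (real^'m) set)) else 0)"
  using integral_fourier_mode[of "k - l"]
  by (simp add: cnj_fourier_mode fourier_mode_mult) (simp add: scaleR_conv_of_real)

section \<open>Trigonometric polynomials and uniform approximation\<close>

definition trig_poly :: "(real^'m \<Rightarrow> complex) \<Rightarrow> bool" where
  "trig_poly T \<longleftrightarrow> (\<exists>K a. finite K \<and> T = (\<lambda>\<theta>. \<Sum>k\<in>K. fourier_mode k \<theta> * a k))"

lemma trig_poly_fourier_mode: "trig_poly (\<lambda>\<theta>. fourier_mode k \<theta> * c)"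
  unfolding trig_poly_def by (rule exI[of _ "{k}"], rule exI[of _ "\<lambda>_. c"]) simp

lemma trig_poly_const: "trig_poly (\<lambda>_. c)"
  using trig_poly_fourier_mode[of 0 c] by simp

lemma trig_poly_add:
  assumes "trig_poly S" "trig_poly T"
  shows "trig_poly (\<lambda>\<theta>. S \<theta> + T \<theta>)"
proof -
  obtain K a where K: "finite K" "S = (\<lambda>\<theta>. \<Sum>k\<in>K. fourier_mode k \<theta> * a k)"
    using assms(1) unfolding trig_poly_def by blast
  obtain L b where L: "finite L" "T = (\<lambda>\<theta>. \<Sum>k\<in>L. fourier_mode k \<theta> * b k)"
    using assms(2) unfolding trig_poly_def by blast
  have "S \<theta> + T \<theta> =
      (\<Sum>k\<in>K \<union> L. fourier_mode k \<theta> * ((if k \<in> K then a k else 0) + (if k \<in> L then b k else 0)))" for \<theta>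
  proof -
    have "S \<theta> = (\<Sum>k\<in>K \<union> L. fourier_mode k \<theta> * (if k \<in> K then a k else 0))"
      unfolding K(2) using K(1) L(1) by (intro sum.mono_neutral_cong_left) auto
    moreover have "T \<theta> = (\<Sum>k\<in>K \<union> L. fourier_mode k \<theta> * (if k \<in> L then b k else 0))"
      unfolding L(2) using K(1) L(1) by (intro sum.mono_neutral_cong_left) auto
    ultimately show ?thesis by (simp only: distrib_left sum.distrib)
  qed
  then have "(\<lambda>\<theta>. S \<theta> + T \<theta>) = (\<lambda>\<theta>. \<Sum>k\<in>K \<union> L. fourier_mode k \<theta> *
      ((if k \<in> K then a k else 0) + (if k \<in> L then b k else 0)))"
    by (rule ext)
  then show ?thesis
    unfolding trig_poly_def
    by (intro exI[of _ "K \<union> L"] exI[of _ "\<lambda>k. (if k \<in> K then a k else 0) + (if k \<in> L then b k else 0)"]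
        conjI finite_UnI K(1) L(1))
qed

lemma trig_poly_sum:
  assumes "finite I" "\<And>i. i \<in> I \<Longrightarrow> trig_poly (T i)"
  shows "trig_poly (\<lambda>\<theta>. \<Sum>i\<in>I. T i \<theta>)"
  using assms
proof (induction I)
  case (insert i I)
  then show ?case
    using trig_poly_add[of "T i" "\<lambda>\<theta>. \<Sum>i\<in>I. T i \<theta>"] by simp
qed (simp add: trig_poly_const)

lemma trig_poly_mult:
  assumes "trig_poly S" "trig_poly T"
  shows "trig_poly (\<lambda>\<theta>. S \<theta> * T \<theta>)"
proof -
  obtain K a where K: "finite K" "S = (\<lambda>\<theta>. \<Sum>k\<in>K. fourier_mode k \<theta> * a k)"
    using assms(1) unfolding trig_poly_def by blast
  obtain L b where L: "finite L" "T = (\<lambda>\<theta>. \<Sum>k\<in>L. fourier_mode k \<theta> * b k)"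
    using assms(2) unfolding trig_poly_def by blast
  have eq: "fourier_mode k \<theta> * a k * (fourier_mode l \<theta> * b l) = fourier_mode (k + l) \<theta> * (a k * b l)" for k l \<theta>
    by (simp add: fourier_mode_mult[symmetric])
  have "(\<lambda>\<theta>. S \<theta> * T \<theta>) = (\<lambda>\<theta>. \<Sum>k\<in>K. \<Sum>l\<in>L. fourier_mode (k + l) \<theta> * (a k * b l))"
    unfolding K(2) L(2) sum_product eq ..
  then show ?thesis
    by (simp only:) (intro trig_poly_sum trig_poly_fourier_mode K(1) L(1))
qed

lemma trig_poly_continuous:
  assumes "trig_poly T"
  shows "continuous_on UNIV T"
proof -
  obtain K a where "T = (\<lambda>\<theta>. \<Sum>k\<in>K. fourier_mode k \<theta> * a k)"
    using assms unfolding trig_poly_def by blast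
  then show ?thesis
    by (simp only:) (intro continuous_on_sum continuous_on_mult continuous_on_const continuous_fourier_mode)
qed

text \<open>Euler's formulas. These are the real and imaginary parts of the coordinates of the torus
  in \<open>complex^'m\<close>, which will separate points for Stone--Weierstrass.\<close>

lemma
  fixes j :: "'m::finite"
  shows trig_poly_cos: "trig_poly (\<lambda>\<theta>. of_real (cos (\<theta> $ j)))"
  and trig_poly_sin: "trig_poly (\<lambda>\<theta>. of_real (sin (\<theta> $ j)))"
proof -
  have e: "fourier_mode (axis j n) \<theta> = exp (\<i> * of_real (of_int n * \<theta> $ j))" for n and \<theta> :: "real^'m"
  proof -
    have "int_vec (axis j n) = axis j (of_int n)"
      by (simp add: int_vec_def axis_def vec_eq_iff)
    then show ?thesis by (simp add: fourier_mode_def inner_axis')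
  qed
  have "of_real (cos (\<theta> $ j)) = fourier_mode (axis j 1) \<theta> * (1/2) + fourier_mode (axis j (-1)) \<theta> * (1/2)" for \<theta> :: "real^'m"
    by (simp add: e cos_exp_eq flip: cos_of_real)
  then show "trig_poly (\<lambda>\<theta>. of_real (cos (\<theta> $ j)))"
    by (simp only:) (intro trig_poly_add trig_poly_fourier_mode)
  have "of_real (sin (\<theta> $ j)) =
      fourier_mode (axis j 1) \<theta> * (- (\<i>/2)) + fourier_mode (axis j (-1)) \<theta> * (\<i>/2)" for \<theta> :: "real^'m"
    by (simp add: e sin_exp_eq algebra_simps diff_divide_distrib flip: sin_of_real)
  then show "trig_poly (\<lambda>\<theta>. of_real (sin (\<theta> $ j)))"
    by (simp only:) (intro trig_poly_add trig_poly_fourier_mode)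
qed

text \<open>The difference of the angles is 2 \<pi> n with |n| at most 1, and n = 1 or n = -1 forces
  the two endpoints. Hence wrapping the cube onto the torus identifies points only on its
  faces.\<close>

lemma cis_eq_imp:
  assumes "cis a = cis b" "a \<in> {0..2*pi}" "b \<in> {0..2*pi}"
  shows "a = b \<or> a \<in> {0, 2*pi} \<and> b \<in> {0, 2*pi}"
proof -
  have "sin a = sin b \<and> cos a = cos b"
    using assms(1) by (simp add: cis.ctr)
  then obtain n :: int where n: "a = b + 2 * pi * n"
    unfolding sin_cos_eq_iff by (auto simp: mult.commute mult.left_commute)
  have "2 * pi * n \<le> 2 * pi * 1" "2 * pi * (- 1) \<le> 2 * pi * n"
    unfolding mult_minus_right mult_1_right using assms(2,3) n
    by (simp_all only: atLeastAtMost_iff, linarith+)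
  then have "real_of_int n \<le> 1" "- 1 \<le> real_of_int n"
    using mult_le_cancel_left_pos[of "2 * pi" n 1] mult_le_cancel_left_pos[of "2 * pi" "- 1" n]
    by (simp_all only: pi_gt_zero mult_pos_pos zero_less_numeral)
  then have "n = 0 \<or> n = 1 \<or> n = -1" by linarith
  then show ?thesis using n assms(2,3) by auto
qed

text \<open>
  A function vanishing on the boundary of the cube factors through the torus in
  \<open>complex^'m\<close>, where trigonometric polynomials separate points.
\<close>

lemma trig_poly_uniform_approx:
  fixes h :: "real^'m \<Rightarrow> real"
  assumes cont: "continuous_on cube h"
    and boundary: "\<And>\<theta> j. \<theta> \<in> cube \<Longrightarrow> \<theta> $ j \<in> {0, 2*pi} \<Longrightarrow> h \<theta> = 0"
    and e: "0 < e"
  obtains T where "trig_poly T" "\<And>\<theta>. \<theta> \<in> cube \<Longrightarrow> norm (of_real (h \<theta>) - T \<theta>) < e"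
proof -
  define E :: "real^'m \<Rightarrow> complex^'m" where "E \<theta> = (\<chi> j. cis (\<theta> $ j))" for \<theta>
  have contE: "continuous_on A E" for A
    unfolding E_def by (intro continuous_on_vec_lambda continuous_intros)
  have h_eq: "h \<theta> = h \<theta>'" if "\<theta> \<in> cube" "\<theta>' \<in> cube" "E \<theta> = E \<theta>'" for \<theta> \<theta>'
  proof (cases "\<theta> = \<theta>'")
    case False
    then obtain j where "\<theta> $ j \<noteq> \<theta>' $ j" by (auto simp: vec_eq_iff)
    moreover have "cis (\<theta> $ j) = cis (\<theta>' $ j)" using that(3) by (simp add: E_def vec_eq_iff)
    ultimately have "\<theta> $ j \<in> {0, 2*pi}" "\<theta>' $ j \<in> {0, 2*pi}"
      using cis_eq_imp[of "\<theta> $ j" "\<theta>' $ j"] that(1,2) by auto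
    then have "h \<theta> = 0" "h \<theta>' = 0"
      using boundary[OF that(1)] boundary[OF that(2)] by blast+
    then show ?thesis by simp
  qed simp
  \<comment> \<open>\<open>F\<close> evaluates \<open>h\<close> at an arbitrary preimage; by
    \<open>h_eq\<close> the choice does not matter on the image of the cube.\<close>
  define F where "F z = h (SOME \<theta>. \<theta> \<in> cube \<and> E \<theta> = z)" for z
  have F: "F (E \<theta>) = h \<theta>" if "\<theta> \<in> cube" for \<theta>
  proof -
    have "(SOME \<theta>'. \<theta>' \<in> cube \<and> E \<theta>' = E \<theta>) \<in> cube \<and> E (SOME \<theta>'. \<theta>' \<in> cube \<and> E \<theta>' = E \<theta>) = E \<theta>"
      by (rule someI[where P = "\<lambda>\<theta>'. \<theta>' \<in> cube \<and> E \<theta>' = E \<theta>"]) (use that in simp)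
    then show ?thesis
      unfolding F_def using h_eq that by blast
  qed
  have compact: "compact (E ` cube)"
    by (intro compact_continuous_image contE compact_cube)
  \<comment> \<open>\<open>E\<close> is not injective, so continuity cannot come from an inverse.
    Instead, preimages of closed sets under \<open>F\<close> are images under \<open>E\<close> of
    compact sets.\<close>
  have contF: "continuous_on (E ` cube) F"
  proof (subst continuous_on_closed_vimage)
    show "closed (E ` cube)" using compact by (rule compact_imp_closed)
    show "\<forall>B. closed B \<longrightarrow> closed (F -` B \<inter> E ` cube)"
    proof (intro allI impI)
      fix B :: "real set" assume "closed B"
      then have "closed (h -` B \<inter> cube)"
        using cont compact_imp_closed[OF compact_cube] continuous_on_closed_vimage by blast
      then have "compact (cube \<inter> (h -` B \<inter> cube))"
        by (intro compact_Int_closed compact_cube)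
      then have "compact (E ` (cube \<inter> (h -` B \<inter> cube)))"
        by (intro compact_continuous_image contE)
      moreover have "F -` B \<inter> E ` cube = E ` (cube \<inter> (h -` B \<inter> cube))"
        using F by auto
      ultimately show "closed (F -` B \<inter> E ` cube)"
        by (simp only: compact_imp_closed)
    qed
  qed
  \<comment> \<open>The real Stone--Weierstrass theorem is applied on the image of the cube;
    membership in \<open>R\<close> records that pulling back along \<open>E\<close> gives a
    trigonometric polynomial.\<close>
  define R where "R = {\<phi>. continuous_on (E ` cube) \<phi> \<and> trig_poly (\<lambda>\<theta>. of_real (\<phi> (E \<theta>)))}"
  interpret function_ring_on R "E ` cube"
  proof
    show "compact (E ` cube)" by fact
    show "continuous_on (E ` cube) \<phi>" if "\<phi> \<in> R" for \<phi>
      using that by (simp add: R_def)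
    show "(\<lambda>x. \<phi> x + \<psi> x) \<in> R" if "\<phi> \<in> R" "\<psi> \<in> R" for \<phi> \<psi>
      using that by (auto simp: R_def intro: continuous_on_add trig_poly_add)
    show "(\<lambda>x. \<phi> x * \<psi> x) \<in> R" if "\<phi> \<in> R" "\<psi> \<in> R" for \<phi> \<psi>
      using that by (auto simp: R_def intro: continuous_on_mult trig_poly_mult)
    show "(\<lambda>_. c) \<in> R" for c
      by (simp add: R_def trig_poly_const)
    have "(\<lambda>z. Re (z $ j)) \<in> R" "(\<lambda>z. Im (z $ j)) \<in> R" for j
      by (auto simp: R_def E_def trig_poly_cos trig_poly_sin intro!: continuous_intros)
    then show "\<exists>\<phi>\<in>R. \<phi> z \<noteq> \<phi> w" if "z \<noteq> w" for z w
      using that by (metis (no_types, lifting) complex_eqI vec_eq_iff)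
  qed
  obtain \<phi> where \<phi>: "\<phi> \<in> R" "\<forall>z\<in>E ` cube. \<bar>F z - \<phi> z\<bar> < e"
    using Stone_Weierstrass_basic[OF contF e] by blast
  show thesis
  proof
    show "trig_poly (\<lambda>\<theta>. of_real (\<phi> (E \<theta>)))" using \<phi>(1) by (simp add: R_def)
    show "norm (of_real (h \<theta>) - (of_real (\<phi> (E \<theta>)) :: complex)) < e" if "\<theta> \<in> cube" for \<theta>
    proof -
      have "\<bar>h \<theta> - \<phi> (E \<theta>)\<bar> < e"
        using bspec[OF \<phi>(2) imageI[OF that]] F[OF that] by (simp only:)
      then show ?thesis by (simp flip: of_real_diff)
    qed
  qed
qed

section \<open>Density of trigonometric polynomials in L^2\<close>

definition clip :: "real \<Rightarrow> real \<Rightarrow> real" where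
  "clip M x = max (- M) (min M x)"

lemma continuous_on_clip [continuous_intros]:
  "continuous_on A f \<Longrightarrow> continuous_on A (\<lambda>x. clip M (f x))"
  unfolding clip_def by (intro continuous_intros)

lemma clip_measurable [measurable]: "clip M \<in> borel_measurable borel"
  by (intro borel_measurable_continuous_onI continuous_intros)

lemma abs_clip_le: "0 \<le> M \<Longrightarrow> \<bar>clip M x\<bar> \<le> M"
  by (simp add: clip_def)

lemma clip_eq: "\<bar>x\<bar> \<le> M \<Longrightarrow> clip M x = x"
  by (simp add: clip_def)

lemma abs_diff_clip_le: "0 \<le> M \<Longrightarrow> \<bar>x - clip M x\<bar> \<le> \<bar>x\<bar>"
  by (auto simp: clip_def)

text \<open>At each point the clipping has no effect once the level exceeds the value there, and the
  squared error is dominated by the square of \<open>f\<close>; dominated convergence does the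
  rest.\<close>

lemma square_integrable_clip_approx:
  fixes f :: "real^'m \<Rightarrow> real"
  assumes f: "square_integrable f" and e: "0 < e"
  obtains M where "0 \<le> M" "(\<integral>\<theta>. (norm (f \<theta> - clip M (f \<theta>)))\<^sup>2 \<partial>torus) < e"
proof -
  have [measurable]: "f \<in> borel_measurable torus" using f by (rule square_integrableD(1))
  have "(\<lambda>n. \<integral>\<theta>. (norm (f \<theta> - clip (real n) (f \<theta>)))\<^sup>2 \<partial>torus) \<longlonglongrightarrow> (\<integral>\<theta>. 0 \<partial>(torus :: (real^'m) measure))"
  proof (rule integral_dominated_convergence[OF _ _ square_integrableD(2)[OF f]])
    show "AE \<theta> in torus. (\<lambda>n. (norm (f \<theta> - clip (real n) (f \<theta>)))\<^sup>2) \<longlonglongrightarrow> 0"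
    proof (rule AE_I2)
      fix \<theta>
      obtain n0 :: nat where "\<bar>f \<theta>\<bar> \<le> n0" using real_arch_simple by blast
      then have "(norm (f \<theta> - clip (real n) (f \<theta>)))\<^sup>2 = 0" if "n0 \<le> n" for n
        using that by (simp add: clip_eq)
      then show "(\<lambda>n. (norm (f \<theta> - clip (real n) (f \<theta>)))\<^sup>2) \<longlonglongrightarrow> 0"
        by (intro tendsto_eventually) (auto simp: eventually_sequentially)
    qed
    show "AE \<theta> in torus. norm ((norm (f \<theta> - clip (real n) (f \<theta>)))\<^sup>2) \<le> (norm (f \<theta>))\<^sup>2" for n
    proof (rule AE_I2)
      fix \<theta>
      show "norm ((norm (f \<theta> - clip (real n) (f \<theta>)))\<^sup>2) \<le> (norm (f \<theta>))\<^sup>2"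
        using power_mono[OF abs_diff_clip_le[of "real n" "f \<theta>"], of 2] by simp
    qed
  qed measurable
  then have "eventually (\<lambda>n. (\<integral>\<theta>. (norm (f \<theta> - clip (real n) (f \<theta>)))\<^sup>2 \<partial>torus) < e) sequentially"
    using e by (intro order_tendstoD(2)) auto
  then obtain n where "(\<integral>\<theta>. (norm (f \<theta> - clip (real n) (f \<theta>)))\<^sup>2 \<partial>torus) < e"
    by (auto simp: eventually_sequentially)
  then show ?thesis
    by (intro that[of "real n"]) auto
qed

text \<open>Measurability yields continuous functions converging to \<open>f\<close> almost
  everywhere on the cube. Clipping at \<open>M\<close> keeps the limit and provides a constant
  dominating function; a cut-off makes the approximants vanish on the faces.\<close>

lemma bounded_continuous_approx:
  fixes f :: "real^'m \<Rightarrow> real"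
  assumes f: "f \<in> borel_measurable torus" and M: "\<And>\<theta>. \<bar>f \<theta>\<bar> \<le> M" and e: "0 < e"
  obtains h where "continuous_on UNIV h"
    "\<And>\<theta> j. \<theta> $ j \<in> {0, 2*pi} \<Longrightarrow> h \<theta> = 0"
    "(\<integral>\<theta>. (norm (f \<theta> - h \<theta>))\<^sup>2 \<partial>torus) < e"
proof -
  have "0 \<le> M" using M[of 0] by linarith
  have [measurable]: "f \<in> borel_measurable torus" by fact
  have "f measurable_on cube"
    using f unfolding torus_def by (subst measurable_on_iff_borel_measurable[OF cube_lebesgue])
  then obtain N g where N: "negligible N" and g: "\<And>n. continuous_on UNIV (g n)"
    and lim: "\<And>\<theta>. \<theta> \<notin> N \<Longrightarrow> (\<lambda>n. g n \<theta>) \<longlonglongrightarrow> (if \<theta> \<in> cube then f \<theta> else 0)"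
    unfolding measurable_on_def by blast
  \<comment> \<open>Each factor is 0 on its pair of faces, and equals 1 for large \<open>n\<close>
    at any point strictly between them.\<close>
  define \<eta> :: "nat \<Rightarrow> real^'m \<Rightarrow> real" where
    "\<eta> n \<theta> = (\<Prod>j\<in>UNIV. min 1 (real n * (\<theta> $ j * (2*pi - \<theta> $ j))))" for n \<theta>
  define h where "h n \<theta> = \<eta> n \<theta> * clip M (g n \<theta>)" for n \<theta>
  have h_cont: "continuous_on UNIV (h n)" for n
    unfolding h_def \<eta>_def by (intro continuous_intros g)
  have h_boundary: "h n \<theta> = 0" if "\<theta> $ j \<in> {0, 2*pi}" for n \<theta> j
  proof -
    have "\<eta> n \<theta> = 0"
      unfolding \<eta>_def using that by (intro prod_zero bexI[of _ j]) auto
    then show ?thesis by (simp add: h_def)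
  qed
  have h_bound: "\<bar>h n \<theta>\<bar> \<le> M" if "\<theta> \<in> cube" for n \<theta>
  proof -
    have "0 \<le> \<eta> n \<theta>" "\<eta> n \<theta> \<le> 1"
      unfolding \<eta>_def using that by (auto intro!: prod_nonneg prod_le_1)
    then have "\<bar>h n \<theta>\<bar> \<le> 1 * M"
      unfolding h_def abs_mult using \<open>0 \<le> M\<close> by (intro mult_mono abs_clip_le) auto
    then show ?thesis by simp
  qed
  \<comment> \<open>The faces join the exceptional set, since the cut-off stays 0 there and does not
    tend to 1.\<close>
  let ?N = "N \<union> (\<Union>j. {\<theta>. \<theta> \<bullet> axis j 1 = 0}) \<union> (\<Union>j. {\<theta>. \<theta> \<bullet> axis j 1 = 2*pi})"
  have "negligible ?N"
    using N by (intro negligible_Un negligible_Union)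
      (auto intro!: negligible_standard_hyperplane simp: Basis_vec_def)
  have [measurable]: "h n \<in> borel_measurable torus" for n
    by (rule continuous_measurable_torus[OF h_cont])
  have "(\<lambda>n. \<integral>\<theta>. (norm (f \<theta> - h n \<theta>))\<^sup>2 \<partial>torus) \<longlonglongrightarrow> (\<integral>\<theta>. 0 \<partial>(torus :: (real^'m) measure))"
  proof (rule integral_dominated_convergence[where w = "\<lambda>_. (2 * M)\<^sup>2"])
    show "AE \<theta> in torus. (\<lambda>n. (norm (f \<theta> - h n \<theta>))\<^sup>2) \<longlonglongrightarrow> 0"
    proof (rule AE_torusI[OF \<open>negligible ?N\<close>])
      fix \<theta> :: "real^'m" assume \<theta>: "\<theta> \<in> cube" "\<theta> \<notin> ?N"
      have pos: "0 < \<theta> $ j * (2*pi - \<theta> $ j)" for j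
      proof -
        have "\<theta> $ j \<noteq> 0" "\<theta> $ j \<noteq> 2*pi" using \<theta>(2) by (auto simp: inner_axis)
        moreover have "0 \<le> \<theta> $ j" "\<theta> $ j \<le> 2*pi" using \<theta>(1) by auto
        ultimately show ?thesis by (intro mult_pos_pos) linarith+
      qed
      have "(\<lambda>n. min 1 (real n * (\<theta> $ j * (2*pi - \<theta> $ j)))) \<longlonglongrightarrow> 1" for j
      proof -
        obtain n0 :: nat where n0: "1 < n0 * (\<theta> $ j * (2*pi - \<theta> $ j))"
          using reals_Archimedean3[OF pos] by blast
        have "min 1 (real n * (\<theta> $ j * (2*pi - \<theta> $ j))) = 1" if "n0 \<le> n" for n
        proof -
          have "real n0 * (\<theta> $ j * (2*pi - \<theta> $ j)) \<le> real n * (\<theta> $ j * (2*pi - \<theta> $ j))"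
            using that pos[of j] by (intro mult_right_mono) auto
          with n0 show ?thesis by linarith
        qed
        then show ?thesis
          by (intro tendsto_eventually) (auto simp: eventually_sequentially)
      qed
      then have "(\<lambda>n. \<eta> n \<theta>) \<longlonglongrightarrow> (\<Prod>j\<in>(UNIV::'m set). 1)"
        unfolding \<eta>_def by (intro tendsto_prod)
      moreover have "(\<lambda>n. clip M (g n \<theta>)) \<longlonglongrightarrow> clip M (f \<theta>)"
        unfolding clip_def using lim[of \<theta>] \<theta> by (intro tendsto_intros) auto
      ultimately have "(\<lambda>n. h n \<theta>) \<longlonglongrightarrow> (\<Prod>j\<in>(UNIV::'m set). 1) * clip M (f \<theta>)"
        unfolding h_def by (rule tendsto_mult)
      then have "(\<lambda>n. h n \<theta>) \<longlonglongrightarrow> f \<theta>"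
        by (simp add: clip_eq M)
      then have "(\<lambda>n. (norm (f \<theta> - h n \<theta>))\<^sup>2) \<longlonglongrightarrow> (norm (f \<theta> - f \<theta>))\<^sup>2"
        by (intro tendsto_intros)
      then show "(\<lambda>n. (norm (f \<theta> - h n \<theta>))\<^sup>2) \<longlonglongrightarrow> 0" by simp
    qed
    show "AE \<theta> in torus. norm ((norm (f \<theta> - h n \<theta>))\<^sup>2) \<le> (2 * M)\<^sup>2" for n
    proof (rule AE_I2)
      fix \<theta> :: "real^'m" assume "\<theta> \<in> space torus"
      then have "\<bar>f \<theta> - h n \<theta>\<bar> \<le> 2 * M" using h_bound[of \<theta> n] M[of \<theta>] by simp
      then have "\<bar>f \<theta> - h n \<theta>\<bar>\<^sup>2 \<le> (2 * M)\<^sup>2" by (intro power_mono) auto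
      then show "norm ((norm (f \<theta> - h n \<theta>))\<^sup>2) \<le> (2 * M)\<^sup>2" by simp
    qed
    show "(\<lambda>\<theta>. (norm (f \<theta> - h n \<theta>))\<^sup>2) \<in> borel_measurable torus" for n
      by measurable
  qed simp_all
  then have "eventually (\<lambda>n. (\<integral>\<theta>. (norm (f \<theta> - h n \<theta>))\<^sup>2 \<partial>torus) < e) sequentially"
    using e by (intro order_tendstoD(2)) auto
  then obtain n where "(\<integral>\<theta>. (norm (f \<theta> - h n \<theta>))\<^sup>2 \<partial>torus) < e"
    by (auto simp: eventually_sequentially)
  then show ?thesis
    using that[of "h n"] h_cont h_boundary by blast
qed

text \<open>Stands in for the triangle inequality of the L^2 norm: no square roots appear, at the
  price of doubling both errors.\<close>

lemma integral_norm_add_square_le: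
  assumes f: "square_integrable f" and g: "square_integrable g"
  shows "(\<integral>\<theta>. (norm (f \<theta> + g \<theta>))\<^sup>2 \<partial>torus) \<le>
    2 * (\<integral>\<theta>. (norm (f \<theta>))\<^sup>2 \<partial>torus) + 2 * (\<integral>\<theta>. (norm (g \<theta>))\<^sup>2 \<partial>torus)"
proof -
  note int = square_integrableD(2)[OF f] square_integrableD(2)[OF g]
  have "(\<integral>\<theta>. (norm (f \<theta> + g \<theta>))\<^sup>2 \<partial>torus) \<le>
      (\<integral>\<theta>. 2 * (norm (f \<theta>))\<^sup>2 + 2 * (norm (g \<theta>))\<^sup>2 \<partial>torus)"
    using int
    by (intro integral_mono square_integrableD(2)[OF square_integrable_add[OF f g]] norm_add_square_le) auto
  also have "\<dots> = 2 * (\<integral>\<theta>. (norm (f \<theta>))\<^sup>2 \<partial>torus) + 2 * (\<integral>\<theta>. (norm (g \<theta>))\<^sup>2 \<partial>torus)"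
    using int by simp
  finally show ?thesis .
qed

lemma square_integrable_of_real:
  "square_integrable f \<Longrightarrow> square_integrable (\<lambda>\<theta>. complex_of_real (f \<theta>))"
  unfolding square_integrable_def by (auto intro: borel_measurable_of_real)

lemma square_integrable_trig_poly: "trig_poly T \<Longrightarrow> square_integrable T"
  by (intro square_integrable_continuous trig_poly_continuous)

lemma trig_poly_L2_approx_real:
  fixes f :: "real^'m \<Rightarrow> real"
  assumes f: "square_integrable f" and e: "0 < e"
  obtains T where "trig_poly T" "(\<integral>\<theta>. (norm (of_real (f \<theta>) - T \<theta>))\<^sup>2 \<partial>torus) < e"
proof -
  \<comment> \<open>Two errors of e/16 combine to 2 (e/16 + e/16) = e/4 for \<open>f - h\<close>;
    with another e/4 from the trigonometric approximation the total is below 2 (e/4 + e/4) =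
    e.\<close>
  obtain M where M: "0 \<le> M" "(\<integral>\<theta>. (norm (f \<theta> - clip M (f \<theta>)))\<^sup>2 \<partial>torus) < e / 16"
    using square_integrable_clip_approx[OF f, of "e / 16"] e by auto
  have [measurable]: "f \<in> borel_measurable torus" using f by (rule square_integrableD(1))
  have cf: "(\<lambda>\<theta>. clip M (f \<theta>)) \<in> borel_measurable torus" by measurable
  obtain h where h: "continuous_on UNIV h" "\<And>\<theta> j. \<theta> $ j \<in> {0, 2*pi} \<Longrightarrow> h \<theta> = 0"
    "(\<integral>\<theta>. (norm (clip M (f \<theta>) - h \<theta>))\<^sup>2 \<partial>torus) < e / 16"
    using bounded_continuous_approx[OF cf, of M "e / 16"] abs_clip_le[OF M(1)] e by auto
  let ?\<mu> = "measure torus (cube :: (real^'m) set)"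
  \<comment> \<open>The uniform error whose square, integrated over the cube, is exactly
    e/4.\<close>
  define \<delta> where "\<delta> = sqrt (e / (4 * ?\<mu>))"
  have \<delta>: "0 < \<delta>" "\<delta>\<^sup>2 * ?\<mu> = e / 4"
    using e measure_torus_pos[where 'm='m] by (simp_all add: \<delta>_def)
  obtain T where T: "trig_poly T" "\<And>\<theta>. \<theta> \<in> cube \<Longrightarrow> norm (of_real (h \<theta>) - T \<theta>) < \<delta>"
    by (rule trig_poly_uniform_approx[OF continuous_on_subset[OF h(1) subset_UNIV] _ \<delta>(1)])
       (rule h(2), assumption, rule that)
  have clip: "square_integrable (\<lambda>\<theta>. clip M (f \<theta>))"
    by (rule square_integrable_bound[OF cf, of "\<lambda>_. M\<^sup>2"])
       (use power_mono[OF abs_clip_le[OF M(1)], of _ 2] in auto)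
  have hsq: "square_integrable h" by (rule square_integrable_continuous[OF h(1)])
  have Tsq: "square_integrable T" by (rule square_integrable_trig_poly[OF T(1)])
  have fh: "square_integrable (\<lambda>\<theta>. f \<theta> - h \<theta>)"
    by (rule square_integrable_diff[OF f hsq])
  have hT: "square_integrable (\<lambda>\<theta>. of_real (h \<theta>) - T \<theta>)"
    by (rule square_integrable_diff[OF square_integrable_of_real[OF hsq] Tsq])
  have "(\<integral>\<theta>. (norm (f \<theta> - h \<theta>))\<^sup>2 \<partial>torus) < e / 4"
    using integral_norm_add_square_le[OF square_integrable_diff[OF f clip] square_integrable_diff[OF clip hsq]]
      M(2) h(3) by simp
  moreover have "(\<integral>\<theta>. (norm (complex_of_real (h \<theta>) - T \<theta>))\<^sup>2 \<partial>torus) \<le> e / 4"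
  proof -
    have "(\<integral>\<theta>. (norm (complex_of_real (h \<theta>) - T \<theta>))\<^sup>2 \<partial>torus) \<le> (\<integral>\<theta>. \<delta>\<^sup>2 \<partial>(torus :: (real^'m) measure))"
      by (intro integral_mono square_integrableD(2)[OF hT] power_mono less_imp_le[OF T(2)])
        simp_all
    also have "\<dots> = e / 4" using \<delta>(2) by (simp add: mult.commute)
    finally show ?thesis .
  qed
  moreover have "(\<integral>\<theta>. (norm (of_real (f \<theta>) - T \<theta>))\<^sup>2 \<partial>torus) \<le>
      2 * (\<integral>\<theta>. (norm (f \<theta> - h \<theta>))\<^sup>2 \<partial>torus) +
      2 * (\<integral>\<theta>. (norm (complex_of_real (h \<theta>) - T \<theta>))\<^sup>2 \<partial>torus)"
    using integral_norm_add_square_le[OF square_integrable_of_real[OF fh] hT]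
    by (simp del: of_real_diff add: norm_of_real) (simp add: of_real_diff)
  ultimately have "(\<integral>\<theta>. (norm (of_real (f \<theta>) - T \<theta>))\<^sup>2 \<partial>torus) < e"
    by linarith
  then show ?thesis using that[OF T(1)] by blast
qed

text \<open>Real and imaginary parts are approximated separately, each within e/4 because adding the
  errors doubles them. The approximants may themselves be complex valued:
  \<open>S + T * \<i>\<close> is a trigonometric polynomial in any case.\<close>

lemma trig_poly_L2_approx:
  fixes f :: "real^'m \<Rightarrow> complex"
  assumes f: "square_integrable f" and e: "0 < e"
  obtains T where "trig_poly T" "(\<integral>\<theta>. (norm (f \<theta> - T \<theta>))\<^sup>2 \<partial>torus) < e"
proof -
  have [measurable]: "f \<in> borel_measurable torus" using f by (rule square_integrableD(1))
  have Re: "square_integrable (\<lambda>\<theta>. Re (f \<theta>))"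
    by (rule square_integrable_bound[OF _ square_integrableD(2)[OF f]])
       (auto simp: cmod_power2)
  have Im: "square_integrable (\<lambda>\<theta>. Im (f \<theta>))"
    by (rule square_integrable_bound[OF _ square_integrableD(2)[OF f]])
       (auto simp: cmod_power2)
  obtain S where S: "trig_poly S" "(\<integral>\<theta>. (norm (of_real (Re (f \<theta>)) - S \<theta>))\<^sup>2 \<partial>torus) < e / 4"
    using trig_poly_L2_approx_real[OF Re, of "e / 4"] e by auto
  obtain T where T: "trig_poly T" "(\<integral>\<theta>. (norm (of_real (Im (f \<theta>)) - T \<theta>))\<^sup>2 \<partial>torus) < e / 4"
    using trig_poly_L2_approx_real[OF Im, of "e / 4"] e by auto
  let ?g = "\<lambda>\<theta>. of_real (Re (f \<theta>)) - S \<theta>" and ?h = "\<lambda>\<theta>. of_real (Im (f \<theta>)) - T \<theta>"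
  have g: "square_integrable ?g"
    by (intro square_integrable_diff square_integrable_of_real Re square_integrable_trig_poly S)
  have h: "square_integrable ?h"
    by (intro square_integrable_diff square_integrable_of_real Im square_integrable_trig_poly T)
  have "square_integrable (\<lambda>\<theta>. \<i> * ?h \<theta>)"
    by (rule square_integrable_bound[OF _ square_integrableD(2)[OF h]])
       (use square_integrableD(1)[OF h] in \<open>auto simp: norm_mult\<close>)
  from integral_norm_add_square_le[OF g this]
  have "(\<integral>\<theta>. (norm (?g \<theta> + \<i> * ?h \<theta>))\<^sup>2 \<partial>torus) < e"
    using S(2) T(2) by (simp add: norm_mult)
  moreover have "?g \<theta> + \<i> * ?h \<theta> = f \<theta> - (S \<theta> + T \<theta> * \<i>)" for \<theta>
    by (simp add: complex_eq_iff)
  ultimately have "(\<integral>\<theta>. (norm (f \<theta> - (S \<theta> + T \<theta> * \<i>)))\<^sup>2 \<partial>torus) < e"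
    by simp
  then show ?thesis
    using that[OF trig_poly_add[OF S(1) trig_poly_mult[OF T(1) trig_poly_const]]] by blast
qed

section \<open>Fourier sums as best approximations, and their convergence\<close>

definition fourier_coeff :: "(real^'m \<Rightarrow> complex) \<Rightarrow> int^'m \<Rightarrow> complex" where
  "fourier_coeff f k = (\<integral>\<theta>. f \<theta> * cnj (fourier_mode k \<theta>) \<partial>torus) / of_real (measure torus (cube :: (real^'m) set))"

text \<open>Pythagoras: the residual \<open>g\<close> of the Fourier sum is orthogonal to every mode
  in \<open>K\<close>, hence to the difference \<open>D\<close> of the two sums. The cross term
  integrates to 0 and only the nonnegative square of \<open>D\<close> is added.\<close>

lemma fourier_coeff_best_approx:
  fixes f :: "real^'m \<Rightarrow> complex"
  assumes f: "square_integrable f" and K: "finite K"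
  shows "(\<integral>\<theta>. (norm (f \<theta> - (\<Sum>k\<in>K. fourier_mode k \<theta> * fourier_coeff f k)))\<^sup>2 \<partial>torus) \<le>
    (\<integral>\<theta>. (norm (f \<theta> - (\<Sum>k\<in>K. fourier_mode k \<theta> * b k)))\<^sup>2 \<partial>torus)"
proof -
  let ?\<mu> = "complex_of_real (measure torus (cube :: (real^'m) set))"
  let ?e = "fourier_mode :: int^'m \<Rightarrow> real^'m \<Rightarrow> complex"
  have \<mu>: "?\<mu> \<noteq> 0" using measure_torus_pos[where 'm='m] by simp
  have mode: "square_integrable (\<lambda>\<theta>. ?e k \<theta> * c)" for k c
    by (intro square_integrable_trig_poly trig_poly_fourier_mode)
  have mode': "square_integrable (?e k)" for k
    using mode[of k 1] by simp
  have sum: "square_integrable (\<lambda>\<theta>. \<Sum>k\<in>K. ?e k \<theta> * c k)" for c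
    by (intro square_integrable_sum K mode)
  define g where "g \<theta> = f \<theta> - (\<Sum>k\<in>K. ?e k \<theta> * fourier_coeff f k)" for \<theta>
  define d where "d k = fourier_coeff f k - b k" for k
  define D where "D \<theta> = (\<Sum>k\<in>K. ?e k \<theta> * d k)" for \<theta>
  have g: "square_integrable g" unfolding g_def by (intro square_integrable_diff f sum)
  have D: "square_integrable D" unfolding D_def by (rule sum)
  have orth: "(\<integral>\<theta>. g \<theta> * cnj (?e k \<theta>) \<partial>torus) = 0" if "k \<in> K" for k
  proof -
    have "(\<integral>\<theta>. g \<theta> * cnj (?e k \<theta>) \<partial>torus) =
        (\<integral>\<theta>. f \<theta> * cnj (?e k \<theta>) - (\<Sum>l\<in>K. fourier_coeff f l * (?e l \<theta> * cnj (?e k \<theta>))) \<partial>torus)"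
      by (simp only: g_def left_diff_distrib sum_distrib_right) (simp only: mult_ac)
    also have "\<dots> = (\<integral>\<theta>. f \<theta> * cnj (?e k \<theta>) \<partial>torus) -
        (\<Sum>l\<in>K. fourier_coeff f l * (\<integral>\<theta>. ?e l \<theta> * cnj (?e k \<theta>) \<partial>torus))"
      using integrable_mult_cnj[OF f mode'] integrable_mult_cnj[OF mode' mode'] by simp
    also have "\<dots> = (\<integral>\<theta>. f \<theta> * cnj (?e k \<theta>) \<partial>torus) - fourier_coeff f k * ?\<mu>"
      using K that by (simp add: fourier_mode_orthogonal if_distrib[of "\<lambda>x. _ * x"] cong: if_cong)
    also have "\<dots> = 0" using \<mu> by (simp add: fourier_coeff_def)
    finally show ?thesis .
  qed
  have "(\<integral>\<theta>. g \<theta> * cnj (D \<theta>) \<partial>torus) = (\<integral>\<theta>. (\<Sum>k\<in>K. cnj (d k) * (g \<theta> * cnj (?e k \<theta>))) \<partial>torus)"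
    by (simp add: D_def sum_distrib_left mult.commute mult.left_commute)
  also have "\<dots> = (\<Sum>k\<in>K. cnj (d k) * (\<integral>\<theta>. g \<theta> * cnj (?e k \<theta>) \<partial>torus))"
    using integrable_mult_cnj[OF g mode'] by simp
  also have "\<dots> = 0" by (simp add: orth)
  finally have gD: "(\<integral>\<theta>. g \<theta> * cnj (D \<theta>) \<partial>torus) = 0" .
  have int_gD: "integrable torus (\<lambda>\<theta>. g \<theta> * cnj (D \<theta>))" by (rule integrable_mult_cnj[OF g D])
  define r where "r \<theta> = Re (g \<theta> * cnj (D \<theta>))" for \<theta>
  have r: "integrable torus r" "(\<integral>\<theta>. r \<theta> \<partial>torus) = 0"
    unfolding r_def[abs_def] by (rule integrable_Re[OF int_gD]) (simp only: integral_Re[OF int_gD] gD, simp)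
  have eq: "(norm (f \<theta> - (\<Sum>k\<in>K. ?e k \<theta> * b k)))\<^sup>2 =
      (norm (g \<theta>))\<^sup>2 + (norm (D \<theta>))\<^sup>2 + 2 * r \<theta>" for \<theta>
  proof -
    have "f \<theta> - (\<Sum>k\<in>K. ?e k \<theta> * b k) = g \<theta> + D \<theta>"
      by (simp add: g_def D_def d_def right_diff_distrib sum_subtractf)
    then show ?thesis
      by (simp add: r_def cmod_power2 power2_sum)
  qed
  have "(\<integral>\<theta>. (norm (f \<theta> - (\<Sum>k\<in>K. ?e k \<theta> * b k)))\<^sup>2 \<partial>torus) =
      (\<integral>\<theta>. (norm (g \<theta>))\<^sup>2 \<partial>torus) + (\<integral>\<theta>. (norm (D \<theta>))\<^sup>2 \<partial>torus)"
    unfolding eq using square_integrableD(2)[OF g] square_integrableD(2)[OF D] r by simp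
  moreover have "0 \<le> (\<integral>\<theta>. (norm (D \<theta>))\<^sup>2 \<partial>torus)" by simp
  ultimately show ?thesis
    unfolding g_def[symmetric] by simp
qed

text \<open>If a trigonometric polynomial with frequencies in \<open>L\<close> is close to
  \<open>f\<close>, it competes in the approximation over every finite \<open>K\<close> containing
  \<open>L\<close>, and the Fourier sum over \<open>K\<close> does at least as well. This gives
  convergence along all finite sets, with no ordering of the frequencies.\<close>

lemma fourier_series_L2:
  fixes f :: "real^'m \<Rightarrow> complex"
  assumes f: "square_integrable f"
  shows "((\<lambda>K. \<integral>\<theta>. (norm (f \<theta> - (\<Sum>k\<in>K. fourier_mode k \<theta> * fourier_coeff f k)))\<^sup>2 \<partial>torus) \<longlongrightarrow> 0)
    (finite_subsets_at_top UNIV)"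
proof (rule order_tendstoI)
  fix e :: real assume "0 < e"
  then obtain T where T: "trig_poly T" "(\<integral>\<theta>. (norm (f \<theta> - T \<theta>))\<^sup>2 \<partial>torus) < e"
    using trig_poly_L2_approx[OF f] by blast
  obtain L b where L: "finite L" "T = (\<lambda>\<theta>. \<Sum>k\<in>L. fourier_mode k \<theta> * b k)"
    using T(1) unfolding trig_poly_def by blast
  have "(\<integral>\<theta>. (norm (f \<theta> - (\<Sum>k\<in>K. fourier_mode k \<theta> * fourier_coeff f k)))\<^sup>2 \<partial>torus) < e"
    if "finite K" "L \<subseteq> K" for K
  proof -
    have "T \<theta> = (\<Sum>k\<in>K. fourier_mode k \<theta> * (if k \<in> L then b k else 0))" for \<theta>
      unfolding L(2) using that by (intro sum.mono_neutral_cong_left) auto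
    with fourier_coeff_best_approx[OF f \<open>finite K\<close>, of "\<lambda>k. if k \<in> L then b k else 0"] T(2)
    show ?thesis by simp
  qed
  then show "\<forall>\<^sub>F K in finite_subsets_at_top UNIV.
      (\<integral>\<theta>. (norm (f \<theta> - (\<Sum>k\<in>K. fourier_mode k \<theta> * fourier_coeff f k)))\<^sup>2 \<partial>torus) < e"
    unfolding eventually_finite_subsets_at_top using L(1) by blast
next
  fix e :: real assume "e < 0"
  then show "\<forall>\<^sub>F K in finite_subsets_at_top UNIV.
      e < (\<integral>\<theta>. (norm (f \<theta> - (\<Sum>k\<in>K. fourier_mode k \<theta> * fourier_coeff f k)))\<^sup>2 \<partial>torus)"
    by (intro always_eventually allI) (rule less_le_trans, assumption, simp)
qed

text \<open>The squared norm is the sum of the squared moduli of the components, so the scalar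
  result applies to each component.\<close>

theorem fourier_L2_sum_exists:
  fixes f :: "real^'m \<Rightarrow> complex^'q"
  assumes f: "L2_torus f"
  shows "\<exists>a. fourier_L2_sum a f"
proof -
  have f': "square_integrable f"
    using f by (simp add: L2_torus_def square_integrable_def)
  have comp: "square_integrable (\<lambda>\<theta>. f \<theta> $ i)" for i
  proof (rule square_integrable_bound[OF _ square_integrableD(2)[OF f']])
    show "(\<lambda>\<theta>. f \<theta> $ i) \<in> borel_measurable torus"
      by (rule measurable_compose[OF square_integrableD(1)[OF f']])
         (intro borel_measurable_continuous_onI continuous_intros)
    show "(norm (f \<theta> $ i))\<^sup>2 \<le> (norm (f \<theta>))\<^sup>2" for \<theta>
      by (intro power_mono Finite_Cartesian_Product.norm_nth_le) auto
  qed
  let ?a = "\<lambda>k. \<chi> i. fourier_coeff (\<lambda>\<theta>. f \<theta> $ i) k"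
  let ?S = "\<lambda>K \<theta>. \<Sum>k\<in>K. fourier_mode k \<theta> *s ?a k"
  let ?s = "\<lambda>K i \<theta>. \<Sum>k\<in>K. fourier_mode k \<theta> * fourier_coeff (\<lambda>\<theta>. f \<theta> $ i) k"
  have eq: "(\<integral>\<theta>. (norm (f \<theta> - ?S K \<theta>))\<^sup>2 \<partial>torus) = (\<Sum>i\<in>UNIV. \<integral>\<theta>. (norm (f \<theta> $ i - ?s K i \<theta>))\<^sup>2 \<partial>torus)"
    if "finite K" for K
  proof -
    have "square_integrable (\<lambda>\<theta>. f \<theta> $ i - ?s K i \<theta>)" for i
      by (intro square_integrable_diff comp square_integrable_sum that square_integrable_trig_poly
          trig_poly_fourier_mode)
    note int = square_integrableD(2)[OF this]
    have "(norm (f \<theta> - ?S K \<theta>))\<^sup>2 = (\<Sum>i\<in>UNIV. (norm (f \<theta> $ i - ?s K i \<theta>))\<^sup>2)" for \<theta>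
      by (simp add: norm_vec_def L2_set_def sum_nonneg)
    then show ?thesis
      using int by simp
  qed
  have "((\<lambda>K. \<Sum>i\<in>UNIV. \<integral>\<theta>. (norm (f \<theta> $ i - ?s K i \<theta>))\<^sup>2 \<partial>torus) \<longlongrightarrow> (\<Sum>i\<in>(UNIV::'q set). 0))
      (finite_subsets_at_top UNIV)"
    by (intro tendsto_sum fourier_series_L2 comp)
  then have "((\<lambda>K. \<Sum>i\<in>UNIV. \<integral>\<theta>. (norm (f \<theta> $ i - ?s K i \<theta>))\<^sup>2 \<partial>torus) \<longlongrightarrow> 0)
      (finite_subsets_at_top UNIV)"
    by (simp only: sum.neutral_const)
  then have "((\<lambda>K. \<integral>\<theta>. (norm (f \<theta> - ?S K \<theta>))\<^sup>2 \<partial>torus) \<longlongrightarrow> 0) (finite_subsets_at_top UNIV)"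
    by (rule Lim_transform_eventually)
      (rule eventually_finite_subsets_at_top_weakI, simp only: eq)
  then show ?thesis
    using f unfolding fourier_L2_sum_def by (intro exI[of _ ?a] conjI)
qed

section \<open>Linear change of variables in a power series\<close>

text \<open>
  Expanding \<open>(N x)\<^sup>m\<close> means choosing, for each of the \<open>|m|\<close> linear factors (the slots, where \<open>(j, t)\<close> is
  the \<open>t\<close>-th copy of row \<open>j\<close>), one summand \<open>N\<^sub>j\<^sub>i x\<^sub>i\<close>; a word records these choices.
\<close>

definition slots :: "nat^'d \<Rightarrow> ('d \<times> nat) set" where
  "slots m = (SIGMA j:UNIV. {..<m $ j})"

text \<open>Extensional functions on the slots: each choice is counted once and the set is
  finite.\<close>

definition words :: "nat^'d \<Rightarrow> ('d \<times> nat \<Rightarrow> 'd) set" where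
  "words m = (slots m \<rightarrow>\<^sub>E UNIV)"

text \<open>The multi-exponent of the monomial in \<open>x\<close> produced by a word.\<close>

definition letter_count :: "nat^'d \<Rightarrow> ('d \<times> nat \<Rightarrow> 'd) \<Rightarrow> nat^'d" where
  "letter_count m f = (\<chi> i. card {s \<in> slots m. f s = i})"

definition word_coeff :: "'a::comm_semiring_1^'d^'d \<Rightarrow> nat^'d \<Rightarrow> ('d \<times> nat \<Rightarrow> 'd) \<Rightarrow> 'a" where
  "word_coeff N m f = (\<Prod>s\<in>slots m. N $ fst s $ f s)"

text \<open>Indexes all terms, over all \<open>m\<close>, that contribute to the monomial of
  exponent \<open>l\<close> after the substitution.\<close>

definition words_with_count :: "nat^'d \<Rightarrow> ((nat^'d) \<times> ('d \<times> nat \<Rightarrow> 'd)) set" where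
  "words_with_count l = {(m, f). f \<in> words m \<and> letter_count m f = l}"

lemma finite_slots [simp]: "finite (slots m)"
  by (simp add: slots_def)

lemma finite_words [simp]: "finite (words m)"
  by (simp add: words_def finite_PiE)

lemma card_slots: "card (slots m) = (\<Sum>j\<in>UNIV. m $ j)"
  by (simp add: slots_def)

lemma prod_slots: "(\<Prod>s\<in>slots m. g (fst s)) = (\<Prod>j\<in>UNIV. g j ^ (m $ j))"
proof -
  have "(\<Prod>s\<in>slots m. g (fst s)) = (\<Prod>j\<in>UNIV. \<Prod>t<m $ j. g j)"
    unfolding slots_def by (subst prod.Sigma) (auto simp: case_prod_beta)
  then show ?thesis by simp
qed

text \<open>The letters partition the slots: the substitution preserves the total degree.\<close>

lemma sum_letter_count: "(\<Sum>i\<in>UNIV. letter_count m f $ i) = (\<Sum>j\<in>UNIV. m $ j)"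
proof -
  have "(\<Sum>i\<in>UNIV. card {s \<in> slots m. f s = i}) = card (slots m)"
    using sum.group[of "slots m" UNIV f "\<lambda>_. 1::nat"] by simp
  then show ?thesis
    by (simp add: letter_count_def card_slots)
qed

text \<open>By preservation of degree, \<open>m\<close> must have the same total degree as
  \<open>l\<close>, which leaves finitely many \<open>m\<close>, each with finitely many words. This
  makes the new coefficients finite sums.\<close>

lemma finite_words_with_count: "finite (words_with_count (l :: nat^'d))"
proof -
  let ?n = "\<Sum>i\<in>UNIV. l $ i"
  have "{m :: nat^'d. (\<Sum>j\<in>UNIV. m $ j) = ?n} \<subseteq> (\<lambda>g. \<chi> j. g j) ` (UNIV \<rightarrow>\<^sub>E {..?n})"
  proof
    fix m :: "nat^'d" assume m: "m \<in> {m. (\<Sum>j\<in>UNIV. m $ j) = ?n}"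
    have "m $ j \<le> ?n" for j
      using member_le_sum[of j UNIV "\<lambda>j. m $ j"] m by simp
    then show "m \<in> (\<lambda>g. \<chi> j. g j) ` (UNIV \<rightarrow>\<^sub>E {..?n})"
      by (intro image_eqI[of _ _ "\<lambda>j. m $ j"]) auto
  qed
  then have "finite {m :: nat^'d. (\<Sum>j\<in>UNIV. m $ j) = ?n}"
    by (rule finite_subset) (intro finite_imageI finite_PiE; simp)
  then have "finite (SIGMA m:{m :: nat^'d. (\<Sum>j\<in>UNIV. m $ j) = ?n}. words m)"
    by (rule finite_SigmaI) simp
  then show ?thesis
  proof (rule finite_subset[rotated])
    show "words_with_count l \<subseteq> (SIGMA m:{m. (\<Sum>j\<in>UNIV. m $ j) = ?n}. words m)"
      by (auto simp: words_with_count_def sum_letter_count)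
  qed
qed

lemma mpow_matrix_vector_mult:
  fixes N :: "'a::comm_semiring_1^'d^'d"
  shows "mpow (N *v x) m = (\<Sum>f\<in>words m. word_coeff N m f * mpow x (letter_count m f))"
proof -
  have "mpow (N *v x) m = (\<Prod>s\<in>slots m. \<Sum>i\<in>UNIV. N $ fst s $ i * x $ i)"
    by (simp add: mpow_def matrix_vector_mult_def prod_slots[of "\<lambda>j. \<Sum>i\<in>UNIV. N $ j $ i * x $ i"])
  also have "\<dots> = (\<Sum>f\<in>words m. \<Prod>s\<in>slots m. N $ fst s $ f s * x $ f s)"
    unfolding words_def by (rule prod_sum_PiE) auto
  also have "\<dots> = (\<Sum>f\<in>words m. word_coeff N m f * mpow x (letter_count m f))"
  proof (rule sum.cong[OF refl])
    fix f
    \<comment> \<open>Slots are grouped by their letter; a group contributes a power of one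
      coordinate of \<open>x\<close>.\<close>
    have "(\<Prod>s\<in>slots m. x $ f s) = (\<Prod>i\<in>UNIV. \<Prod>s\<in>{s \<in> slots m. f s = i}. x $ f s)"
      by (rule prod.group[symmetric]) auto
    also have "\<dots> = mpow x (letter_count m f)"
      by (simp add: mpow_def letter_count_def)
    finally show "(\<Prod>s\<in>slots m. N $ fst s $ f s * x $ f s) =
        word_coeff N m f * mpow x (letter_count m f)"
      by (simp add: prod.distrib word_coeff_def)
  qed
  finally show ?thesis .
qed

section \<open>Rearranging a power series after a linear substitution\<close>

lemma norm_vector_scalar_mult: "norm (c *s v) = norm c * norm (v :: complex^'q)"
  by (simp add: norm_vec_def norm_mult L2_set_right_distrib)

lemma mpow_cvec: "mpow (cvec y) m *s v = mpow y m *\<^sub>R v"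
proof -
  have "mpow (cvec y) m = of_real (mpow y m)"
    by (simp add: mpow_def cvec_def)
  then show ?thesis
    by (simp add: vec_eq_iff) (simp add: scaleR_conv_of_real)
qed

text \<open>One absolutely summable family over pairs \<open>(m, f)\<close> is summed in two ways:
  over \<open>f\<close> first it returns the series in \<open>y\<close>, and grouped by
  \<open>letter_count\<close> it becomes the series in \<open>x\<close>.\<close>

lemma has_sum_change_of_variables:
  fixes N :: "complex^'d^'d" and b :: "nat^'d \<Rightarrow> complex^'q"
  assumes y: "N *v x = cvec y"
    and sum: "((\<lambda>m. mpow y m *\<^sub>R b m) has_sum S) UNIV"
    and abs: "(\<lambda>m. mpow ((\<chi> j i. norm (N $ j $ i)) *v (\<chi> i. norm (x $ i))) m * norm (b m)) summable_on UNIV"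
  shows "((\<lambda>l. mpow x l *s (\<Sum>(m, f)\<in>words_with_count l. word_coeff N m f *s b m)) has_sum S) UNIV"
proof -
  define g where "g = (\<lambda>(m, f). (word_coeff N m f * mpow x (letter_count m f)) *s b m)"
  let ?N = "\<chi> j i. norm (N $ j $ i)" and ?x = "\<chi> i. norm (x $ i)"
  have norm_g: "norm (g (m, f)) = word_coeff ?N m f * mpow ?x (letter_count m f) * norm (b m)" for m f
    by (simp add: g_def norm_vector_scalar_mult norm_mult word_coeff_def mpow_def prod_norm[symmetric] norm_power)
  \<comment> \<open>The norms are again the terms of such an expansion, for the moduli of
    \<open>N\<close> and \<open>x\<close>, so their inner sums are the terms of
    \<open>abs\<close>.\<close>
  have "(\<lambda>p. norm (g p)) summable_on Sigma UNIV words"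
    using abs
    by (simp add: Infinite_Sum.abs_summable_on_Sigma_iff norm_g flip: sum_distrib_right mpow_matrix_vector_mult)
       (simp add: mpow_def abs_mult abs_prod matrix_vector_mult_def sum_nonneg)
  then obtain S' where S': "(g has_sum S') (Sigma UNIV words)"
    using abs_summable_summable summable_on_def by blast
  have "(\<Sum>f\<in>words m. g (m, f)) = mpow y m *\<^sub>R b m" for m
    by (simp add: g_def flip: vec.scale_sum_left mpow_matrix_vector_mult)
       (simp add: y mpow_cvec)
  then have inner: "((\<lambda>f. g (m, f)) has_sum mpow y m *\<^sub>R b m) (words m)" for m
    using has_sum_finite[OF finite_words, of "\<lambda>f. g (m, f)" m] by simp
  have "((\<lambda>m. mpow y m *\<^sub>R b m) has_sum S') UNIV"
    using has_sum_Sigma[OF isUCont_plus S' inner] .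
  then have "S' = S"
    using sum by (rule has_sum_unique)
  \<comment> \<open>Every pair \<open>(m, f)\<close> has exactly one letter count.\<close>
  have "bij_betw (\<lambda>(l, mf). mf) (Sigma UNIV words_with_count) (Sigma UNIV words)"
    by (rule bij_betwI[where g = "\<lambda>(m, f). (letter_count m f, m, f)"])
       (auto simp: words_with_count_def)
  from has_sum_reindex_bij_betw[OF this, of g S'] S'
  have "((\<lambda>p. g (snd p)) has_sum S) (Sigma UNIV words_with_count)"
    by (simp add: \<open>S' = S\<close> case_prod_beta)
  moreover have inner': "((\<lambda>mf. g (snd (l, mf))) has_sum
      mpow x l *s (\<Sum>(m, f)\<in>words_with_count l. word_coeff N m f *s b m)) (words_with_count l)" for l
  proof (rule has_sum_finiteI[OF finite_words_with_count])
    show "mpow x l *s (\<Sum>(m, f)\<in>words_with_count l. word_coeff N m f *s b m) =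
        (\<Sum>mf\<in>words_with_count l. g (snd (l, mf)))"
      unfolding vec.scale_sum_right
      by (rule sum.cong) (auto simp: g_def words_with_count_def mult.commute)
  qed
  ultimately show ?thesis
    using has_sum_Sigma[OF isUCont_plus _ inner'] by blast
qed

lemma mpow_mono:
  fixes x y :: "real^'d"
  assumes "\<And>i. 0 \<le> x $ i" "\<And>i. x $ i \<le> y $ i"
  shows "mpow x m \<le> mpow y m"
  unfolding mpow_def using assms by (intro prod_mono) (auto intro: power_mono)

text \<open>In finite dimension unconditional and absolute summability agree; this reduces to the
  complex components, whose moduli together bound the norm.\<close>

lemma summable_on_imp_abs_summable_vec:
  fixes f :: "'i \<Rightarrow> complex^'q"
  assumes "f summable_on UNIV"
  shows "(\<lambda>m. norm (f m)) summable_on UNIV"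
proof (rule Infinite_Sum.abs_summable_on_comparison_test')
  have "(\<lambda>m. norm (f m $ i)) summable_on UNIV" for i
    using summable_on_bounded_linear[OF bounded_linear_vec_nth assms, of i]
    by (subst (asm) summable_on_iff_abs_summable_on_complex)
  note component = this
  have "(\<lambda>m. \<Sum>i\<in>I. norm (f m $ i)) summable_on UNIV" if "finite I" for I
    using that by induction (simp_all add: component summable_on_add)
  then show "(\<lambda>m. \<Sum>i\<in>UNIV. norm (f m $ i)) summable_on UNIV"
    by simp
  show "norm (f m) \<le> (\<Sum>i\<in>UNIV. norm (f m $ i))" for m
    by (simp add: norm_vec_def L2_set_le_sum)
qed

text \<open>The vector of row sums of moduli is dominated coordinatewise by
  \<open>(t, ..., t)\<close>. Convergence of the original series at this one real point thus
  supplies the absolute summability required for the rearrangement.\<close>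

lemma has_sum_change_of_variables_bounded:
  fixes N :: "complex^'d^'d" and b :: "nat^'d \<Rightarrow> complex^'q"
  assumes y: "N *v x = cvec y"
    and bound: "\<And>j. (\<Sum>i\<in>UNIV. norm (N $ j $ i) * norm (x $ i)) \<le> t" "0 \<le> t"
    and sum: "((\<lambda>m. mpow y m *\<^sub>R b m) has_sum S) UNIV"
    and sum': "(\<lambda>m. mpow (\<chi> j. t) m *\<^sub>R b m) summable_on UNIV"
  shows "((\<lambda>l. mpow x l *s (\<Sum>(m, f)\<in>words_with_count l. word_coeff N m f *s b m)) has_sum S) UNIV"
proof (rule has_sum_change_of_variables[OF y sum])
  let ?X = "(\<chi> j i. norm (N $ j $ i)) *v (\<chi> i. norm (x $ i))"
  have X: "0 \<le> ?X $ j" "?X $ j \<le> t" for j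
    using bound(1)[of j] by (auto simp: matrix_vector_mult_def sum_nonneg)
  show "(\<lambda>m. mpow ?X m * norm (b m)) summable_on UNIV"
  proof (rule summable_on_comparison_test[OF summable_on_imp_abs_summable_vec[OF sum']])
    fix m
    have "0 \<le> mpow ?X m" "0 \<le> mpow (\<chi> j. t) m"
      using X(1) bound(2) unfolding mpow_def by (auto intro!: prod_nonneg)
    then show "0 \<le> mpow ?X m * norm (b m)"
      "mpow ?X m * norm (b m) \<le> norm (mpow (\<chi> j. t) m *\<^sub>R b m)"
      using mpow_mono[of ?X "\<chi> j. t" m] X by (auto intro: mult_right_mono)
  qed
qed

section \<open>Koopman eigenfunctions and expansion\<close>

lemma
  fixes A :: "'a::semiring_1^'n^'m"
  assumes "invertible A"
  shows matrix_inv_right: "A ** matrix_inv A = mat 1"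
    and matrix_inv_left: "matrix_inv A ** A = mat 1"
  using someI_ex[OF assms[unfolded invertible_def]] unfolding matrix_inv_def by auto

lemma bounded_linear_matrix_vector_mult:
  fixes A :: "complex^'n^'m"
  shows "bounded_linear (\<lambda>x. A *v x)"
  by (intro linear_conv_bounded_linear[THEN iffD1] linearI)
    (auto simp: vec_eq_iff matrix_vector_mult_def sum.distrib algebra_simps scaleR_sum_right)

lemma bounded_linear_cvec: "bounded_linear cvec"
  by (intro linear_conv_bounded_linear[THEN iffD1] linearI)
    (auto simp: vec_eq_iff cvec_def complex_eq_iff)

lemma cvec_inject [simp]: "cvec x = cvec y \<longleftrightarrow> x = y"
  by (auto simp: cvec_def vec_eq_iff)

lemma norm_cvec [simp]: "norm (cvec x) = norm x"
  by (simp add: norm_vec_def cvec_def)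

lemma cmat_mult_cvec: "cmat M *v cvec y = cvec (M *v y)"
  by (simp add: vec_eq_iff cmat_def cvec_def map_matrix_def matrix_vector_mult_def)

text \<open>The integrating factor exp(-\<mu> t) makes the product constant.\<close>

lemma exponential_ode_unique:
  fixes v :: "real \<Rightarrow> complex"
  assumes "\<And>t. (v has_vector_derivative \<mu> * v t) (at t)"
  shows "v t = exp (\<mu> * of_real t) * v 0"
proof -
  let ?g = "\<lambda>t. exp (of_real t * - \<mu>) * v t"
  have "(?g has_vector_derivative 0) (at t)" for t
  proof -
    have "((\<lambda>t. exp (of_real t * - \<mu>)) has_vector_derivative - \<mu> * exp (of_real t * - \<mu>)) (at t)"
      using exp_scaleR_has_vector_derivative_left[of "- \<mu>" t]
      by (simp add: scaleR_conv_of_real)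
    from has_vector_derivative_mult[OF this assms[of t]]
    show ?thesis by (simp add: algebra_simps)
  qed
  then obtain c where c: "\<And>t. t \<in> UNIV \<Longrightarrow> ?g t = c"
    by (rule has_vector_derivative_zero_constant[of UNIV ?g, OF convex_UNIV]) (rule that)
  then have "?g t = ?g 0" using c[of t] c[of 0] by simp
  then show ?thesis
    by (simp add: exp_minus field_simps mult.commute)
qed

section \<open>Orbits of the skew system in the coordinates \<open>z\<close>\<close>

locale quasi_floquet =
  fixes A :: "real^'m \<Rightarrow> real^'d^'d"
    and \<omega> :: "real^'m"
    and P :: "real^'m \<Rightarrow> complex^'d^'d"
    and B V :: "complex^'d^'d"
    and \<mu> :: "complex^'d"
  assumes reduction: "quasi_floquet_reduction A \<omega> P B"
    and invertible_V: "invertible V"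
    and diagonal: "matrix_inv V ** B ** V = diag_mat \<mu>"
begin

abbreviation z where "z \<equiv> principal_eigenfunctions P V"

abbreviation solution :: "real^'m \<Rightarrow> (real \<Rightarrow> real^'d) \<Rightarrow> bool" where
  "solution \<theta> y \<equiv> \<forall>t. (y has_vector_derivative A (\<theta> + t *\<^sub>R \<omega>) *v y t) (at t)"

lemma invertible_P: "invertible (P \<theta>)"
  and continuous_P: "continuous_on UNIV P"
  and periodic_P: "torus_periodic P"
  using reduction by (auto simp: quasi_floquet_reduction_def)

lemma solution_iff:
  "(\<forall>t. (w has_vector_derivative B *v w t) (at t)) \<longleftrightarrow>
        (\<forall>t. ((\<lambda>t. P (\<theta> + t *\<^sub>R \<omega>) *v w t) has_vector_derivative
               cmat (A (\<theta> + t *\<^sub>R \<omega>)) *v (P (\<theta> + t *\<^sub>R \<omega>) *v w t)) (at t))"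
  using reduction unfolding quasi_floquet_reduction_def by blast

lemma PV_z: "(P \<theta> ** V) *v z (y, \<theta>) = cvec y"
  using matrix_inv_right[OF invertible_P, of \<theta>] matrix_inv_right[OF invertible_V]
  by (simp add: principal_eigenfunctions_def matrix_vector_mul_assoc)
     (metis matrix_mul_assoc matrix_mul_rid matrix_vector_mul_lid)

lemma z_unique: "z (y, \<theta>) = z (y', \<theta>) \<Longrightarrow> y = y'"
  using PV_z by (metis cvec_inject)

lemma diag_mat_mult: "(diag_mat \<mu> *v v) $ i = \<mu> $ i * v $ i"
  by (simp add: diag_mat_def matrix_vector_mult_def if_distrib[of "\<lambda>x. x * _"] cong: if_cong)

lemma inv_V_B: "matrix_inv V ** B = diag_mat \<mu> ** matrix_inv V"
  unfolding diagonal[symmetric]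
  by (metis matrix_inv_right[OF invertible_V] matrix_mul_assoc matrix_mul_rid)

lemma B_V: "B ** V = V ** diag_mat \<mu>"
  unfolding diagonal[symmetric]
  by (metis matrix_inv_right[OF invertible_V] matrix_mul_assoc matrix_mul_lid)

text \<open>\<open>P\<close> is only assumed continuous, so P^-1 y cannot be differentiated by a
  product rule; the equivalence in the definition of the reduction supplies its derivative. Applying
  V^-1 then decouples the equation into scalar ones.\<close>

lemma z_along_solution:
  assumes "solution \<theta> y"
  shows "z (y t, \<theta> + t *\<^sub>R \<omega>) $ i = exp (\<mu> $ i * of_real t) * z (y 0, \<theta>) $ i"
proof -
  let ?w = "\<lambda>t. matrix_inv (P (\<theta> + t *\<^sub>R \<omega>)) *v cvec (y t)"
  have Pw: "P (\<theta> + t *\<^sub>R \<omega>) *v ?w t = cvec (y t)" for t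
    by (simp add: matrix_vector_mul_assoc matrix_inv_right[OF invertible_P])
  have "\<forall>t. ((\<lambda>t. cvec (y t)) has_vector_derivative cmat (A (\<theta> + t *\<^sub>R \<omega>)) *v cvec (y t)) (at t)"
    unfolding cmat_mult_cvec
    using assms by (intro allI bounded_linear.has_vector_derivative[OF bounded_linear_cvec]) simp
  then have w: "(?w has_vector_derivative B *v ?w t) (at t)" for t
    by (intro solution_iff[of ?w \<theta>, THEN iffD2, rule_format]) (simp only: Pw)
  have z_eq: "z (y t, \<theta> + t *\<^sub>R \<omega>) = matrix_inv V *v ?w t" for t
    by (simp add: principal_eigenfunctions_def)
  have "((\<lambda>t. z (y t, \<theta> + t *\<^sub>R \<omega>)) has_vector_derivative diag_mat \<mu> *v z (y t, \<theta> + t *\<^sub>R \<omega>)) (at t)" for t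
    using bounded_linear.has_vector_derivative[OF bounded_linear_matrix_vector_mult w, of "matrix_inv V" t]
    by (simp only: z_eq matrix_vector_mul_assoc matrix_mul_assoc inv_V_B)
  from bounded_linear.has_vector_derivative[OF bounded_linear_vec_nth this]
  have "((\<lambda>t. z (y t, \<theta> + t *\<^sub>R \<omega>) $ i) has_vector_derivative \<mu> $ i * z (y t, \<theta> + t *\<^sub>R \<omega>) $ i) (at t)" for t
    by (simp add: diag_mat_mult)
  from exponential_ode_unique[OF this, of t] show ?thesis
    by simp
qed

text \<open>Solving the diagonal system explicitly and transforming back gives a complex solution.
  As \<open>A\<close> is real, its real part is a solution too, and it has the prescribed real
  initial value.\<close>

lemma solution_exists: "\<exists>y. solution \<theta> y \<and> y 0 = y\<^sub>0"
proof -
  define v where "v = (\<lambda>t::real. (\<chi> i. exp (of_real t * \<mu> $ i) * z (y\<^sub>0, \<theta>) $ i))"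
  let ?w = "\<lambda>t. V *v v t"
  have "(v has_vector_derivative diag_mat \<mu> *v v t) (at t)" for t
  proof -
    have "((\<lambda>t. v t $ i) has_vector_derivative (diag_mat \<mu> *v v t) $ i) (at t)" for i
    proof -
      have "((\<lambda>t. exp (of_real t * \<mu> $ i)) has_vector_derivative \<mu> $ i * exp (of_real t * \<mu> $ i)) (at t)"
        using exp_scaleR_has_vector_derivative_left[of "\<mu> $ i" t]
        by (simp add: scaleR_conv_of_real)
      from has_vector_derivative_mult[OF this has_vector_derivative_const]
      show ?thesis
        by (simp add: v_def diag_mat_mult mult.assoc)
    qed
    note component = this
    \<comment> \<open>The vector derivative is assembled from the scalar ones by writing a vector as
      the sum of its components along the axes.\<close>
    have axis: "bounded_linear (axis i :: complex \<Rightarrow> complex^'d)" for i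
      by (intro linear_conv_bounded_linear[THEN iffD1] linearI) (auto simp: axis_def vec_eq_iff)
    have "((\<lambda>t. \<Sum>i\<in>UNIV. axis i (v t $ i)) has_vector_derivative
        (\<Sum>i\<in>UNIV. axis i ((diag_mat \<mu> *v v t) $ i))) (at t)"
      by (rule has_vector_derivative_sum)
         (rule bounded_linear.has_vector_derivative[OF axis component])
    moreover have "(\<Sum>i\<in>UNIV. axis i (x $ i)) = x" for x :: "complex^'d"
      by (auto simp: axis_def vec_eq_iff if_distrib cong: if_cong)
    ultimately show ?thesis by simp
  qed
  then have "(?w has_vector_derivative B *v ?w t) (at t)" for t
    using bounded_linear.has_vector_derivative[OF bounded_linear_matrix_vector_mult, of v "diag_mat \<mu> *v v t" "at t" V]
    by (simp add: matrix_vector_mul_assoc B_V)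
  then have sol: "((\<lambda>t. P (\<theta> + t *\<^sub>R \<omega>) *v ?w t) has_vector_derivative
               cmat (A (\<theta> + t *\<^sub>R \<omega>)) *v (P (\<theta> + t *\<^sub>R \<omega>) *v ?w t)) (at t)" for t
    by (rule solution_iff[of ?w \<theta>, THEN iffD1, rule_format])
  let ?R = "\<lambda>x::complex^'d. \<chi> i. Re (x $ i)"
  have R: "bounded_linear ?R"
    by (intro linear_conv_bounded_linear[THEN iffD1] linearI) (auto simp: vec_eq_iff)
  have "?R (cmat M *v x) = M *v ?R x" for M x
    by (simp add: vec_eq_iff cmat_def map_matrix_def matrix_vector_mult_def)
  note eq = this[symmetric]
  have "solution \<theta> (\<lambda>t. ?R (P (\<theta> + t *\<^sub>R \<omega>) *v ?w t))"
    unfolding eq by (rule allI) (rule bounded_linear.has_vector_derivative[OF R sol])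
  moreover have "?R (P \<theta> *v ?w 0) = y\<^sub>0"
  proof -
    have "v 0 = z (y\<^sub>0, \<theta>)" by (simp add: v_def)
    then have "P \<theta> *v ?w 0 = cvec y\<^sub>0"
      using PV_z[of \<theta> y\<^sub>0] by (simp add: matrix_vector_mul_assoc)
    then show ?thesis by (simp add: cvec_def)
  qed
  ultimately show ?thesis by force
qed

text \<open>The definite description in \<open>flow\<close> requires uniqueness. The angle has
  constant derivative \<omega>; the first component then solves the linear system, and its
  \<open>z\<close> coordinates, hence its values, are fixed by the initial point.\<close>

lemma skew_flow:
  obtains y where "solution \<theta> y" "y 0 = y\<^sub>0"
    "\<And>t. flow (skew_field A \<omega>) t (y\<^sub>0, \<theta>) = (y t, \<theta> + t *\<^sub>R \<omega>)"
proof -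
  obtain y where y: "solution \<theta> y" "y 0 = y\<^sub>0"
    using solution_exists by blast
  let ?Q = "\<lambda>u. u 0 = (y\<^sub>0, \<theta>) \<and> (\<forall>s. (u has_vector_derivative skew_field A \<omega> (u s)) (at s))"
  have "(THE u. ?Q u) = (\<lambda>t. (y t, \<theta> + t *\<^sub>R \<omega>))"
  proof (rule the_equality)
    have "((\<lambda>t. (y t, \<theta> + t *\<^sub>R \<omega>)) has_vector_derivative (A (\<theta> + s *\<^sub>R \<omega>) *v y s, \<omega>)) (at s)" for s
    proof (rule has_vector_derivative_Pair)
      show "(y has_vector_derivative A (\<theta> + s *\<^sub>R \<omega>) *v y s) (at s)" using y by blast
      show "((\<lambda>t. \<theta> + t *\<^sub>R \<omega>) has_vector_derivative \<omega>) (at s)"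
        by (auto intro!: derivative_eq_intros simp: has_vector_derivative_def)
    qed
    then show "?Q (\<lambda>t. (y t, \<theta> + t *\<^sub>R \<omega>))"
      using y by (auto simp: skew_field_def)
  next
    fix u assume u: "?Q u"
    then have d: "(u has_vector_derivative (A (snd (u s)) *v fst (u s), \<omega>)) (at s)" for s
      by (simp add: skew_field_def case_prod_beta)
    have snd_u: "snd (u s) = \<theta> + s *\<^sub>R \<omega>" for s
    proof -
      have "((\<lambda>s. snd (u s) - s *\<^sub>R \<omega>) has_vector_derivative \<omega> - \<omega>) (at s)" for s
        using bounded_linear.has_vector_derivative[OF bounded_linear_snd d]
        by (intro has_vector_derivative_diff)
          (auto intro!: derivative_eq_intros simp: has_vector_derivative_def)
      then have "((\<lambda>s. snd (u s) - s *\<^sub>R \<omega>) has_vector_derivative 0) (at s)" for s by simp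
      then obtain c where "\<And>s. s \<in> UNIV \<Longrightarrow> snd (u s) - s *\<^sub>R \<omega> = c"
        by (rule has_vector_derivative_zero_constant[of UNIV "\<lambda>s. snd (u s) - s *\<^sub>R \<omega>", OF convex_UNIV]) (rule that)
      from this[of 0] this[of s] u show ?thesis by (simp add: algebra_simps)
    qed
    have sol: "solution \<theta> (\<lambda>s. fst (u s))"
      using bounded_linear.has_vector_derivative[OF bounded_linear_fst d] by (simp add: snd_u)
    have "fst (u s) = y s" for s
    proof (rule z_unique)
      show "z (fst (u s), \<theta> + s *\<^sub>R \<omega>) = z (y s, \<theta> + s *\<^sub>R \<omega>)"
        using z_along_solution[OF sol, of s] z_along_solution[OF y(1), of s] u y(2)
        by (simp add: vec_eq_iff)
    qed
    then show "u = (\<lambda>t. (y t, \<theta> + t *\<^sub>R \<omega>))"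
      using snd_u by (auto simp: prod_eq_iff)
  qed
  then show ?thesis
    using that[OF y] by (simp add: flow_def)
qed

text \<open>Needed because an eigenfunction must not vanish identically on real \<open>y\<close>.
  Row \<open>i\<close> of V^-1 P^-1 is nonzero by invertibility, so its real or imaginary part is a
  nonzero real vector and the zeros of \<open>z\<close> in component \<open>i\<close> lie in a real
  hyperplane; finitely many hyperplanes do not cover the space.\<close>

lemma z_nonzero: "\<exists>y. \<forall>i. z (y, \<theta>) $ i \<noteq> 0"
proof -
  let ?M = "matrix_inv V ** matrix_inv (P \<theta>)"
  have z: "z (y, \<theta>) = ?M *v cvec y" for y
    by (simp add: principal_eigenfunctions_def matrix_vector_mul_assoc)
  have M: "?M ** (P \<theta> ** V) = mat 1"
  proof -
    have "?M ** (P \<theta> ** V) = matrix_inv V ** (matrix_inv (P \<theta>) ** P \<theta>) ** V"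
      by (simp only: matrix_mul_assoc)
    then show ?thesis
      by (simp add: matrix_inv_left invertible_P invertible_V)
  qed
  have "negligible {y. z (y, \<theta>) $ i = 0}" for i
  proof -
    let ?a = "\<chi> j. Re (?M $ i $ j)" and ?b = "\<chi> j. Im (?M $ i $ j)"
    have "\<exists>j. ?M $ i $ j \<noteq> 0"
    proof (rule ccontr)
      assume "\<not> ?thesis"
      then have "(?M ** (P \<theta> ** V)) $ i $ i = 0"
        by (simp add: matrix_matrix_mult_def[of ?M])
      then show False unfolding M by (simp add: mat_def)
    qed
    then have "?a \<noteq> 0 \<or> ?b \<noteq> 0"
      by (auto simp: vec_eq_iff complex_eq_iff)
    moreover have "{y. z (y, \<theta>) $ i = 0} \<subseteq> {y. ?a \<bullet> y = 0}"
      "{y. z (y, \<theta>) $ i = 0} \<subseteq> {y. ?b \<bullet> y = 0}"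
      unfolding z by (auto simp: matrix_vector_mult_def[of ?M] cvec_def inner_vec_def complex_eq_iff)
    ultimately show ?thesis
      by (blast intro: negligible_subset[OF negligible_hyperplane])
  qed
  then have "negligible (\<Union>i. {y. z (y, \<theta>) $ i = 0})"
    by (intro negligible_Union) auto
  moreover have "\<not> negligible (UNIV :: (real^'d) set)" by simp
  ultimately have "(\<Union>i. {y. z (y, \<theta>) $ i = 0}) \<noteq> UNIV" by metis
  then show ?thesis by blast
qed

lemma mpow_z_along_solution:
  assumes "solution \<theta> y"
  shows "mpow (z (y t, \<theta> + t *\<^sub>R \<omega>)) m =
    exp ((\<Sum>j\<in>UNIV. of_nat (m $ j) * \<mu> $ j) * of_real t) * mpow (z (y 0, \<theta>)) m"
proof -
  have "exp ((\<Sum>j\<in>UNIV. of_nat (m $ j) * \<mu> $ j) * of_real t) =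
      (\<Prod>j\<in>UNIV. exp (\<mu> $ j * of_real t) ^ (m $ j))"
    by (simp add: sum_distrib_right exp_sum mult.assoc exp_of_nat_mult)
  then show ?thesis
    by (simp add: mpow_def z_along_solution[OF assms] power_mult_distrib prod.distrib)
qed

end

section \<open>Periodicity of the modes and the Koopman eigenvalue equation\<close>

lemma int_vec_axis: "int_vec k \<bullet> axis j x = of_int (k $ j) * x"
  by (simp add: int_vec_def inner_axis)

lemma torus_periodic_fourier_mode: "torus_periodic (fourier_mode k)"
proof -
  have "exp (\<i> * (of_int n * (2 * of_real pi))) = 1" for n
    by (simp add: exp_eq_1 mult.commute)
  then show ?thesis
    by (simp add: torus_periodic_def fourier_mode_def inner_add_right int_vec_axis
        distrib_left exp_add)
qed

context quasi_floquet
begin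

theorem koopman_eigenfunction_mpow_z:
  "koopman_eigenfunction (skew_field A \<omega>)
     ((\<Sum>j\<in>UNIV. of_nat (m $ j) * \<mu> $ j) + \<i> * complex_of_real (int_vec k \<bullet> \<omega>))
     (\<lambda>(y, \<theta>). mpow (z (y, \<theta>)) m * fourier_mode k \<theta>)"
  unfolding koopman_eigenfunction_def
proof (intro conjI allI)
  show "torus_periodic (\<lambda>\<theta>. case (y, \<theta>) of (y, \<theta>) \<Rightarrow> mpow (z (y, \<theta>)) m * fourier_mode k \<theta>)" for y
    using periodic_P torus_periodic_fourier_mode[of k]
    by (simp add: torus_periodic_def principal_eigenfunctions_def)
  obtain y where "\<forall>i. z (y, 0) $ i \<noteq> 0" using z_nonzero by blast
  then have "mpow (z (y, 0)) m * fourier_mode k 0 \<noteq> 0"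
    by (simp add: mpow_def fourier_mode_def)
  then show "(\<lambda>(y, \<theta>). mpow (z (y, \<theta>)) m * fourier_mode k \<theta>) \<noteq> (\<lambda>_. 0)"
    by (auto simp: fun_eq_iff)
  fix t
  have "mpow (z (flow (skew_field A \<omega>) t (y, \<theta>))) m * fourier_mode k (snd (flow (skew_field A \<omega>) t (y, \<theta>)))
     = exp (((\<Sum>j\<in>UNIV. of_nat (m $ j) * \<mu> $ j) + \<i> * complex_of_real (int_vec k \<bullet> \<omega>)) * of_real t) *
       (mpow (z (y, \<theta>)) m * fourier_mode k \<theta>)" for y \<theta>
  proof -
    obtain u where u: "solution \<theta> u" "u 0 = y" "\<And>t. flow (skew_field A \<omega>) t (y, \<theta>) = (u t, \<theta> + t *\<^sub>R \<omega>)"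
      using skew_flow by blast
    show ?thesis
      using mpow_z_along_solution[OF u(1), of t m] u(2)
      by (simp add: u(3) fourier_mode_def inner_add_right distrib_left distrib_right exp_add ac_simps)
  qed
  then show "koopman (skew_field A \<omega>) t (\<lambda>(y, \<theta>). mpow (z (y, \<theta>)) m * fourier_mode k \<theta>) =
    (\<lambda>x. exp (((\<Sum>j\<in>UNIV. of_nat (m $ j) * \<mu> $ j) + \<i> * complex_of_real (int_vec k \<bullet> \<omega>)) * of_real t) *
      (case x of (y, \<theta>) \<Rightarrow> mpow (z (y, \<theta>)) m * fourier_mode k \<theta>))"
    by (auto simp: koopman_def fun_eq_iff case_prod_beta)
qed

end

section \<open>Uniform bounds on the torus and the Koopman expansion\<close>

lemma L2_torus_iff: "L2_torus f \<longleftrightarrow> torus_periodic f \<and> square_integrable f"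
  by (auto simp: L2_torus_def square_integrable_def)

lemma square_integrable_scale:
  fixes f :: "real^'m \<Rightarrow> complex^'q"
  assumes \<phi>: "continuous_on UNIV \<phi>" and f: "square_integrable f"
  shows "square_integrable (\<lambda>\<theta>. \<phi> \<theta> *s f \<theta>)"
proof -
  obtain C where C: "\<And>\<theta>. \<theta> \<in> cube \<Longrightarrow> norm (\<phi> \<theta>) \<le> C"
    by (rule continuous_bounded_cube[OF \<phi>]) (rule that)
  show ?thesis
  proof (rule square_integrable_bound)
    have "continuous_on UNIV (\<lambda>x. fst x *s (snd x :: complex^'q))"
      unfolding vector_scalar_mult_def by (intro continuous_intros)
    then show "(\<lambda>\<theta>. \<phi> \<theta> *s f \<theta>) \<in> borel_measurable torus"
      by (rule borel_measurable_continuous_Pair[OF continuous_measurable_torus[OF \<phi>] square_integrableD(1)[OF f]])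
    show "integrable torus (\<lambda>\<theta>. C\<^sup>2 * (norm (f \<theta>))\<^sup>2)"
      using square_integrableD(2)[OF f] by simp
    show "(norm (\<phi> \<theta> *s f \<theta>))\<^sup>2 \<le> C\<^sup>2 * (norm (f \<theta>))\<^sup>2" if "\<theta> \<in> cube" for \<theta>
      unfolding norm_vector_scalar_mult power_mult_distrib
      using C[OF that] by (intro mult_right_mono power_mono) auto
  qed
qed

context quasi_floquet
begin

lemma continuous_PV: "continuous_on UNIV (\<lambda>\<theta>. P \<theta> ** V)"
  unfolding matrix_matrix_mult_def by (intro continuous_intros continuous_P)

lemma invertible_PV: "(P \<theta> ** V) *v w = 0 \<Longrightarrow> w = 0"
  by (metis invertible_P invertible_V invertible_mult invertible_left_inverse
      matrix_vector_mul_assoc matrix_vector_mul_lid matrix_vector_mult_0_right)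

text \<open>Bounds the inverse of \<open>P V\<close> uniformly by compactness: the continuous
  function |P V w| attains a minimum on the cube times the unit sphere, and injectivity makes it
  positive. Its reciprocal is the constant, so only continuity of \<open>P\<close> itself
  enters.\<close>

lemma z_le:
  obtains C where "0 < C" "\<And>\<theta> y. \<theta> \<in> cube \<Longrightarrow> norm (z (y, \<theta>)) \<le> C * norm y"
proof -
  let ?g = "\<lambda>(\<theta>, w). norm ((P \<theta> ** V) *v w)"
  let ?S = "cube \<times> sphere 0 1 :: ((real^'m) \<times> (complex^'d)) set"
  have compact: "compact ?S" by (intro compact_Times) auto
  have nonempty: "?S \<noteq> {}"
  proof -
    have "(0, axis undefined 1) \<in> ?S" by simp
    then show ?thesis by blast
  qed
  have continuous: "continuous_on ?S ?g"
  proof -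
    have "continuous_on ?S (\<lambda>x. P (fst x) ** V)"
      by (rule continuous_on_compose2[OF continuous_PV]) (auto intro: continuous_on_fst continuous_on_id)
    then show ?thesis
      unfolding case_prod_beta matrix_vector_mult_def by (intro continuous_intros)
  qed
  obtain p where p: "p \<in> ?S" "\<forall>q\<in>?S. ?g p \<le> ?g q"
    by (rule continuous_attains_inf[OF compact nonempty continuous, THEN bexE])
  have "snd p \<noteq> 0" using p(1) by auto
  then have pos: "0 < ?g p"
    using invertible_PV[of "fst p" "snd p"] by (auto simp: case_prod_beta)
  show thesis
  proof
    show "0 < 1 / ?g p" using pos by simp
    fix \<theta> :: "real^'m" and y assume \<theta>: "\<theta> \<in> cube"
    let ?w = "z (y, \<theta>)"
    show "norm ?w \<le> 1 / ?g p * norm y"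
    proof (cases "?w = 0")
      case False
      let ?u = "of_real (1 / norm ?w) *s ?w"
      have "norm ?u = 1"
        using False by (simp add: norm_vector_scalar_mult norm_divide)
      then have "?g p \<le> norm ((P \<theta> ** V) *v ?u)"
        using bspec[OF p(2), of "(\<theta>, ?u)"] \<theta> by simp
      also have "\<dots> = norm y / norm ?w"
        by (simp only: vec.scale PV_z norm_vector_scalar_mult) (simp add: norm_divide)
      finally show ?thesis
        using pos False by (simp add: field_simps)
    qed (use pos in simp)
  qed
qed

lemma change_of_variables_bound:
  obtains K where "0 < K" "\<And>\<theta> y j. \<theta> \<in> cube \<Longrightarrow>
    (\<Sum>i\<in>UNIV. norm ((P \<theta> ** V) $ j $ i) * norm (z (y, \<theta>) $ i)) \<le> K * norm y"
proof -
  obtain C where C: "0 < C" "\<And>\<theta> y. \<theta> \<in> cube \<Longrightarrow> norm (z (y, \<theta>)) \<le> C * norm y"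
    using z_le by blast
  obtain D where D: "\<And>\<theta>. \<theta> \<in> cube \<Longrightarrow> norm (P \<theta> ** V) \<le> D"
    by (rule continuous_bounded_cube[OF continuous_PV]) (rule that)
  have "0 \<le> D" by (rule order_trans[OF norm_ge_zero D[of 0]]) simp
  show thesis
  proof
    \<comment> \<open>Each of the \<open>CARD('d)\<close> summands is at most
      \<open>D * C * norm y\<close>; adding 1 secures strict positivity, as \<open>D\<close> is only
      known to be nonnegative.\<close>
    show "0 < real CARD('d) * D * C + 1"
      using C(1) \<open>0 \<le> D\<close> by (intro add_nonneg_pos mult_nonneg_nonneg) auto
    fix \<theta> :: "real^'m" and y j assume \<theta>: "\<theta> \<in> cube"
    have "(\<Sum>i\<in>UNIV. norm ((P \<theta> ** V) $ j $ i) * norm (z (y, \<theta>) $ i)) \<le> (\<Sum>i\<in>(UNIV::'d set). D * (C * norm y))"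
    proof (intro sum_mono mult_mono)
      fix i
      have "norm ((P \<theta> ** V) $ j $ i) \<le> norm (P \<theta> ** V)"
        by (meson Finite_Cartesian_Product.norm_nth_le order_trans)
      then show "norm ((P \<theta> ** V) $ j $ i) \<le> D" using D[OF \<theta>] by linarith
      show "norm (z (y, \<theta>) $ i) \<le> C * norm y"
        by (rule order_trans[OF Finite_Cartesian_Product.norm_nth_le C(2)[OF \<theta>]])
    qed (use \<open>0 \<le> D\<close> in auto)
    also have "\<dots> = real CARD('d) * D * C * norm y" by simp
    also have "\<dots> \<le> (real CARD('d) * D * C + 1) * norm y"
      by (intro mult_right_mono) auto
    finally show "(\<Sum>i\<in>UNIV. norm ((P \<theta> ** V) $ j $ i) * norm (z (y, \<theta>) $ i)) \<le>
      (real CARD('d) * D * C + 1) * norm y" .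
  qed
qed

definition expansion_coeff :: "(nat^'d \<Rightarrow> real^'m \<Rightarrow> complex^'q) \<Rightarrow> nat^'d \<Rightarrow> real^'m \<Rightarrow> complex^'q" where
  "expansion_coeff b l \<theta> = (\<Sum>(m, f)\<in>words_with_count l. word_coeff (P \<theta> ** V) m f *s b m \<theta>)"

lemma L2_torus_expansion_coeff:
  assumes b: "\<And>m. L2_torus (b m)"
  shows "L2_torus (expansion_coeff b l)"
  unfolding L2_torus_iff
proof
  show "torus_periodic (expansion_coeff b l)"
    using periodic_P b by (simp add: torus_periodic_def L2_torus_iff expansion_coeff_def)
  have "continuous_on UNIV (\<lambda>\<theta>. word_coeff (P \<theta> ** V) m f)" for m f
    unfolding word_coeff_def by (intro continuous_intros continuous_PV)
  then show "square_integrable (expansion_coeff b l)"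
    unfolding expansion_coeff_def[abs_def] case_prod_beta
    using b by (intro square_integrable_sum finite_words_with_count square_integrable_scale)
      (auto simp: L2_torus_iff)
qed

theorem koopman_expansion_exists:
  fixes G :: "(real^'d) \<times> (real^'m) \<Rightarrow> complex^'q"
  assumes G: "analytic_L2 \<rho> G"
  shows "\<exists>a R. 0 < R \<and> (\<rho> = \<infinity> \<longrightarrow> R = \<infinity>) \<and> koopman_expansion R z a G"
proof -
  obtain b where \<rho>: "0 < \<rho>" and b: "\<And>m. L2_torus (b m)"
    and sum: "AE \<theta> in torus. \<forall>y. ereal (norm y) < \<rho> \<longrightarrow>
           ((\<lambda>m. mpow y m *\<^sub>R b m \<theta>) has_sum G (y, \<theta>)) UNIV"
    using G unfolding analytic_L2_def by blast
  obtain K\<^sub>0 where K\<^sub>0: "0 < K\<^sub>0" "\<And>\<theta> y j. \<theta> \<in> cube \<Longrightarrow>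
    (\<Sum>i\<in>UNIV. norm ((P \<theta> ** V) $ j $ i) * norm (z (y, \<theta>) $ i)) \<le> K\<^sub>0 * norm y"
    using change_of_variables_bound by blast
  \<comment> \<open>Adding 1 ensures \<open>1 \<le> K\<close> and hence \<open>1 \<le> D\<close>, so
    that \<open>norm y < R\<close> also places \<open>y\<close> itself within radius \<rho>.\<close>
  define K where "K = K\<^sub>0 + 1"
  have K: "(\<Sum>i\<in>UNIV. norm ((P \<theta> ** V) $ j $ i) * norm (z (y, \<theta>) $ i)) \<le> K * norm y"
    if "\<theta> \<in> cube" for \<theta> y j
    using K\<^sub>0(1) order_trans[OF K\<^sub>0(2)[OF that, of j y]] by (simp add: K_def distrib_right)
  have "1 \<le> K" using K\<^sub>0(1) by (simp add: K_def)
  \<comment> \<open>The l1 norm of the point with all coordinates \<open>K * norm y\<close> is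
    \<open>D * norm y\<close>, which bounds its Euclidean norm.\<close>
  define D where "D = real CARD('d) * K"
  have D: "0 < D" "K \<le> D" "1 \<le> D"
  proof -
    have "1 \<le> real CARD('d)" by (simp add: Suc_leI)
    then have "1 * K \<le> D" unfolding D_def using \<open>1 \<le> K\<close> by (intro mult_right_mono) auto
    then show "0 < D" "K \<le> D" "1 \<le> D" using \<open>1 \<le> K\<close> by auto
  qed
  \<comment> \<open>The infinite case is separate because \<open>real_of_ereal \<infinity>\<close>
    is 0.\<close>
  define R where "R = (if \<rho> = \<infinity> then \<infinity> else ereal (real_of_ereal \<rho> / D))"
  have R: "ereal (D * t) < \<rho>" if "ereal t < R" for t
    using that \<rho> D(1) by (cases \<rho>) (auto simp: R_def field_simps)
  have "\<forall>l. \<exists>a. fourier_L2_sum a (expansion_coeff b l)"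
    by (intro allI fourier_L2_sum_exists L2_torus_expansion_coeff b)
  then obtain a where a: "\<forall>l. fourier_L2_sum (a l) (expansion_coeff b l)"
    by (rule choice[THEN exE])
  have "AE \<theta> in torus. \<forall>y. ereal (norm y) < R \<longrightarrow>
      ((\<lambda>l. mpow (z (y, \<theta>)) l *s expansion_coeff b l \<theta>) has_sum G (y, \<theta>)) UNIV"
    using sum
  \<comment> \<open>The exceptional null set is the one from the series of \<open>G\<close>; off it,
    the rearrangement works at every \<theta> of the cube and for all small \<open>y\<close> at
    once.\<close>
  proof (rule AE_mp, intro AE_I2 impI allI)
    fix \<theta> :: "real^'m" and y :: "real^'d"
    assume \<theta>: "\<theta> \<in> space torus" and y: "ereal (norm y) < R"
      and sum: "\<forall>y. ereal (norm y) < \<rho> \<longrightarrow> ((\<lambda>m. mpow y m *\<^sub>R b m \<theta>) has_sum G (y, \<theta>)) UNIV"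
    have \<theta>: "\<theta> \<in> cube" using \<theta> by simp
    have "norm y \<le> D * norm y" using mult_right_mono[OF D(3), of "norm y"] by simp
    then have y\<rho>: "ereal (norm y) < \<rho>"
      by (intro le_less_trans[OF _ R[OF y]]) simp
    let ?Y = "\<chi> j. K * norm y :: real^'d"
    have "norm ?Y \<le> (\<Sum>j\<in>(UNIV::'d set). \<bar>K * norm y\<bar>)"
      using norm_le_l1_cart[of ?Y] by simp
    also have "\<dots> = D * norm y" using \<open>1 \<le> K\<close> by (simp add: D_def abs_mult)
    finally have "ereal (norm ?Y) < \<rho>"
      by (intro le_less_trans[OF _ R[OF y]]) simp
    with sum have "(\<lambda>m. mpow ?Y m *\<^sub>R b m \<theta>) summable_on UNIV"
      unfolding summable_on_def by blast
    then show "((\<lambda>l. mpow (z (y, \<theta>)) l *s expansion_coeff b l \<theta>) has_sum G (y, \<theta>)) UNIV"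
      unfolding expansion_coeff_def
      using sum y\<rho> K[OF \<theta>] \<open>1 \<le> K\<close>
      by (intro has_sum_change_of_variables_bounded[OF PV_z, where t = "K * norm y"]) auto
  qed
  moreover have "0 < R" "\<rho> = \<infinity> \<longrightarrow> R = \<infinity>"
    using \<rho> D(1) by (cases \<rho>; simp add: R_def)+
  ultimately show ?thesis
    unfolding koopman_expansion_def using a
    by (intro exI[of _ a] exI[of _ R] exI[of _ "expansion_coeff b"] conjI)
qed

end

theorem theorem9p1:
  fixes A :: "real^'m \<Rightarrow> real^'d^'d"
    and \<omega> :: "real^'m"
    and c \<gamma> :: real
    and r :: nat
    and P :: "real^'m \<Rightarrow> complex^'d^'d"
    and B V :: "complex^'d^'d"
    and \<mu> :: "complex^'d"
    and \<rho> :: ereal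
    and G :: "(real^'d) \<times> (real^'m) \<Rightarrow> complex^'q"
  assumes "torus_periodic A"
    and "C_class r A"
    and "c > 0" and "\<gamma> > 0" and "diophantine c \<gamma> \<omega>"
    and "\<forall>\<theta>. full_spectrum (\<lambda>t. A (\<theta> + t *\<^sub>R \<omega>))"
    and "quasi_floquet_reduction A \<omega> P B"
    and "invertible V" and "matrix_inv V ** B ** V = diag_mat \<mu>"
    and "inj (\<lambda>j. \<mu> $ j)"
    and "analytic_L2 \<rho> G"
  shows "(\<exists>a :: nat^'d \<Rightarrow> int^'m \<Rightarrow> complex^'q. \<exists>R :: ereal.
            0 < R \<and> (\<rho> = \<infinity> \<longrightarrow> R = \<infinity>) \<and>
            koopman_expansion R (principal_eigenfunctions P V) a G)
       \<and> (\<forall>(m :: nat^'d) (k :: int^'m).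
            koopman_eigenfunction (skew_field A \<omega>)
              ((\<Sum>j\<in>UNIV. of_nat (m $ j) * \<mu> $ j) + \<i> * complex_of_real (int_vec k \<bullet> \<omega>))
              (\<lambda>(y, \<theta>). mpow (principal_eigenfunctions P V (y, \<theta>)) m * fourier_mode k \<theta>))"
proof -
  interpret quasi_floquet A \<omega> P B V \<mu>
    using assms(7-9) by unfold_locales
  show ?thesis
    using koopman_expansion_exists[OF \<open>analytic_L2 \<rho> G\<close>] koopman_eigenfunction_mpow_z by blast
qed

end
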